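(* Let $\{B_n\}$ and $\{C_n\}$ be two matrix sequences such that $B_n$ is Hermitian for all large enough $n$, and put $A_n=B_n+C_n$. Let $G\subset\mathbb R^q$ be a measurable set of finite and positive Lebesgue measure and $\theta:G\to\mathbb C$ a measurable function. Assume that $\{B_n\}\sim_\lambda(\theta,G)$, that both $\|B_n\|$ and $\|C_n\|$ are uniformly bounded by a positive constant $C$ independent of $n$, and that $\|C_n\|_1=o(n)$ as $n\to\infty$. Then $\theta$ is real valued (almost everywhere on $G$) and $\{A_n\}\sim_\lambda(\theta,G)$. In particular, if $S(\theta)$ is the essential range of $\theta$, then $\{A_n\}$ is weakly clustered at $S(\theta)$, and every point $s\in S(\theta)$ strongly attracts $\{A_n\}$ with infinite order.
   Context: A matrix sequence $\{A_n\}$ is a sequence of complex matrices with $A_n$ of size $n\times n$; $\lambda_1(A_n),\dots,\lambda_n(A_n)$ are its eigenvalues counted with multiplicity. $\|\cdot\|$ is the operator (spectral) norm and $\|\cdot\|_1$ is the trace-norm (sum of the singular values). Distribution: $\{A_n\}\sim_\lambda(\theta,G)$ ("$\{A_n\}$ is distributed as $(\theta,G)$ in the sense of the eigenvalues") means that for every continuous $F:\mathbb C\to\mathbb C$ with bounded support, $$\lim_{n\to\infty}\frac1n\sum_{j=1}^nF(\lambda_j(A_n))=\frac1{m(G)}\int_GF(\theta(t))\,dt,$$ where $m$ is Lebesgue measure. Essential range: $S(\theta)$ is the set of $s\in\mathbb C$ such that for every $\varepsilon>0$ the set $\{t\in G:|\theta(t)-s|<\varepsilon\}$ has positive Lebesgue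 measure. Weak clustering: for a nonempty closed $S\subset\mathbb C$ and $\varepsilon>0$ let $D(S,\varepsilon)=\bigcup_{s\in S}\{z:|z-s|<\varepsilon\}$. $\{A_n\}$ is weakly clustered at $S$ if for every $\varepsilon>0$ the number of indices $j$ with $\lambda_j(A_n)\notin D(S,\varepsilon)$ is $o(n)$ as $n\to\infty$. Attraction: a point $s\in\mathbb C$ strongly attracts $\{A_n\}$ with infinite order if, ordering the eigenvalues so that $|\lambda_1(A_n)-s|\le|\lambda_2(A_n)-s|\le\cdots\le|\lambda_n(A_n)-s|$, one has $\lim_{n\to\infty}|\lambda_j(A_n)-s|=0$ for every fixed $j$. *)

theory Defs
  imports
    "HOL-Analysis.Analysis"
    "HOL-Library.Landau_Symbols"
    "HOL-Computational_Algebra.Fundamental_Theorem_Algebra"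
    "Jordan_Normal_Form.Schur_Decomposition"
begin

definition matrix_sequence :: "(nat \<Rightarrow> complex mat) \<Rightarrow> bool" where
  "matrix_sequence A \<longleftrightarrow> (\<forall>n. A n \<in> carrier_mat n n)"

definition hermitian_mat :: "complex mat \<Rightarrow> bool" where
  "hermitian_mat A \<longleftrightarrow> square_mat A \<and> mat_adjoint A = A"

definition eigenvalues :: "complex mat \<Rightarrow> complex multiset" where
  "eigenvalues A = proots (char_poly A)"

definition euclid_norm :: "complex vec \<Rightarrow> real" where
  "euclid_norm v = L2_set (\<lambda>i. cmod (vec_index v i)) {..<dim_vec v}"

text \<open>The closed unit ball is used instead of the unit sphere so that the supremum is over a
  nonempty set also for the \<open>0 \<times> 0\<close> matrix.\<close>

definition spectral_norm :: "complex mat \<Rightarrow> real" where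
  "spectral_norm A =
    (SUP v \<in> {v \<in> carrier_vec (dim_col A). euclid_norm v \<le> 1}. euclid_norm (A *\<^sub>v v))"

text \<open>The singular values are the square roots of the eigenvalues of \<open>A\<^sup>* A\<close>, which are real and
  nonnegative, so that \<^const>\<open>Re\<close> only converts the type.\<close>

definition singular_values :: "complex mat \<Rightarrow> real multiset" where
  "singular_values A = image_mset (\<lambda>z. sqrt (Re z)) (eigenvalues (mat_adjoint A * A))"

definition trace_norm :: "complex mat \<Rightarrow> real" where
  "trace_norm A = sum_mset (singular_values A)"

definition eigenvalue_distribution ::
  "(nat \<Rightarrow> complex mat) \<Rightarrow> ('a::euclidean_space \<Rightarrow> complex) \<Rightarrow> 'a set \<Rightarrow> bool" where
  "eigenvalue_distribution A \<theta> G \<longleftrightarrow>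
    (\<forall>F :: complex \<Rightarrow> complex. continuous_on UNIV F \<longrightarrow> bounded {z. F z \<noteq> 0} \<longrightarrow>
      (\<lambda>n. (\<Sum>z\<in>#eigenvalues (A n). F z) / of_nat n)
        \<longlonglongrightarrow> (LINT t|lebesgue_on G. F (\<theta> t)) / of_real (measure lebesgue G))"

definition essential_range :: "('a::euclidean_space \<Rightarrow> complex) \<Rightarrow> 'a set \<Rightarrow> complex set" where
  "essential_range \<theta> G =
    {s. \<forall>\<epsilon>>0. emeasure lebesgue {t \<in> G. cmod (\<theta> t - s) < \<epsilon>} > 0}"

definition nbhd :: "complex set \<Rightarrow> real \<Rightarrow> complex set" where
  "nbhd S \<epsilon> = (\<Union>s\<in>S. {z. cmod (z - s) < \<epsilon>})"

definition weakly_clustered :: "(nat \<Rightarrow> complex mat) \<Rightarrow> complex set \<Rightarrow> bool" where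
  "weakly_clustered A S \<longleftrightarrow> S \<noteq> {} \<and> closed S \<and>
    (\<forall>\<epsilon>>0. (\<lambda>n. real (size {#z \<in># eigenvalues (A n). z \<notin> nbhd S \<epsilon>#})) \<in> o(\<lambda>n. real n))"

text \<open>Entry \<open>j\<close>, counted from \<open>0\<close>, of the increasingly sorted list of the distances
  \<open>\<bar>\<lambda> - s\<bar>\<close> is \<open>\<bar>\<lambda>\<^sub>j\<^sub>+\<^sub>1(A n) - s\<bar>\<close>. The list has length \<open>n\<close>, so for fixed \<open>j\<close> the
  entry is unspecified only for the finitely many \<open>n \<le> j\<close>.\<close>

definition strongly_attracts_infinite_order ::
  "complex \<Rightarrow> (nat \<Rightarrow> complex mat) \<Rightarrow> bool" where
  "strongly_attracts_infinite_order s A \<longleftrightarrow>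
    (\<forall>j. (\<lambda>n. sorted_list_of_multiset (image_mset (\<lambda>z. cmod (z - s)) (eigenvalues (A n))) ! j)
      \<longlonglongrightarrow> 0)"

end

theory Submission
  imports Defs
begin

text \<open>Only the imaginary parts and the moments of the eigenvalues of \<open>A n = B n + C n\<close> have to be
  controlled, and the trace norm of \<open>C n\<close> controls both.

  Imaginary parts: write \<open>A n\<close> as a unitary conjugate of an upper triangular matrix \<open>P\<^sup>* (A n) P\<close>, so
  that the eigenvalues are diagonal entries. The diagonal of \<open>P\<^sup>* (B n) P\<close> is real, hence every
  \<open>Im \<lambda>\<^sub>j(A n)\<close> is the imaginary part of a diagonal entry of \<open>P\<^sup>* (C n) P\<close>. The absolute values of those
  entries add up to at most the trace norm of \<open>C n\<close> (lemma \<open>sum_Im_eigenvalues_le\<close>), which is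
  \<open>o(n)\<close>. On average the spectrum of \<open>A n\<close> is therefore real.

  Moments: \<open>tr X C\<close> is bounded by the operator norm of \<open>X\<close> times the trace norm of \<open>C\<close> (lemma
  \<open>cmod_mtrace_mult_le\<close>). Telescoping \<open>(B + C)\<^sup>k - B\<^sup>k\<close> into terms with exactly one factor \<open>C\<close>, one gets
  that the \<open>k\<close>-th power sums of the two spectra differ by \<open>O(\<parallel>C n\<parallel>\<^sub>1) = o(n)\<close> for every fixed \<open>k\<close>
  (lemma \<open>power_sum_eigenvalues_diff_le\<close>).

  Both spectra lie in a fixed disc. Moving each eigenvalue of \<open>A n\<close> to its real part changes
  averages of continuous functions by \<open>o(1)\<close>, and on the resulting real points the moments and the
  Weierstrass approximation theorem give equal limits of averages for \<open>A n\<close> and \<open>B n\<close> (lemma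
  \<open>asymptotically_close_imp_same_averages\<close>). This is the distribution claim. Working with
  real parts is what makes polynomials in one real variable suffice: on a disc the polynomials in
  \<open>z\<close> are not dense in the continuous functions.

  The remaining claims follow from a distribution by suitable test functions: one that vanishes
  exactly on the real axis inside a disc forces \<open>\<theta>\<close> to be real almost everywhere, one that is \<open>1\<close>
  away from the essential range counts the outliers, and a bump at a point of the essential range
  has positive integral, so that a positive fraction of the eigenvalues lies near that point.\<close>

section \<open>Adjoints and column norms\<close>

text \<open>The middle dimension does not occur in the conclusion of \<open>mult_carrier_mat\<close>, so the simplifier
  cannot use that rule; for square matrices all dimensions agree.\<close>

lemma square_mult_carrier [simp]:
  "A \<in> carrier_mat n n \<Longrightarrow> B \<in> carrier_mat n n \<Longrightarrow> A * B \<in> carrier_mat n n"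
  by (rule mult_carrier_mat)

lemma mat_adjoint_dim [simp]:
  "dim_row (mat_adjoint A) = dim_col A" "dim_col (mat_adjoint A) = dim_row A"
  by (auto simp: mat_adjoint_def)

lemma mat_adjoint_carrier [simp]:
  "A \<in> carrier_mat n m \<Longrightarrow> mat_adjoint A \<in> carrier_mat m n"
  by (auto intro!: carrier_matI)

lemma mat_adjoint_index [simp]:
  fixes A :: "complex mat"
  assumes "i < dim_col A" "j < dim_row A"
  shows "mat_adjoint A $$ (i, j) = cnj (A $$ (j, i))"
  using assms by (simp add: mat_adjoint_def mat_of_rows_index conjugate_complex_def)

lemma mat_mult_index_sum:
  assumes "A \<in> carrier_mat n m" "B \<in> carrier_mat m k" "i < n" "j < k"
  shows "(A * B) $$ (i, j) = (\<Sum>l<m. A $$ (i, l) * B $$ (l, j))"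
  using assms by (auto simp: scalar_prod_def atLeast0LessThan intro!: sum.cong)

lemma mat_adjoint_mult:
  fixes A B :: "complex mat"
  assumes A: "A \<in> carrier_mat n m" and B: "B \<in> carrier_mat m k"
  shows "mat_adjoint (A * B) = mat_adjoint B * mat_adjoint A"
proof (rule eq_matI)
  fix i j assume "i < dim_row (mat_adjoint B * mat_adjoint A)"
    "j < dim_col (mat_adjoint B * mat_adjoint A)"
  hence ij: "i < k" "j < n" using A B by auto
  have "mat_adjoint (A * B) $$ (i, j) = cnj ((A * B) $$ (j, i))"
    using ij A B by simp
  also have "\<dots> = (\<Sum>l<m. mat_adjoint B $$ (i, l) * mat_adjoint A $$ (l, j))"
    using ij A B by (subst mat_mult_index_sum[OF A B]) (auto simp: mult.commute)
  also have "\<dots> = (mat_adjoint B * mat_adjoint A) $$ (i, j)"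
    using ij A B by (subst mat_mult_index_sum[of _ k m _ n]) auto
  finally show "mat_adjoint (A * B) $$ (i, j) = (mat_adjoint B * mat_adjoint A) $$ (i, j)" .
qed (use A B in auto)

lemma mat_adjoint_four_block:
  fixes A B C D :: "complex mat"
  assumes "A \<in> carrier_mat nr1 nc1" "B \<in> carrier_mat nr1 nc2"
    "C \<in> carrier_mat nr2 nc1" "D \<in> carrier_mat nr2 nc2"
  shows "mat_adjoint (four_block_mat A B C D) =
    four_block_mat (mat_adjoint A) (mat_adjoint C) (mat_adjoint B) (mat_adjoint D)"
  by (rule eq_matI) (use assms in auto)

lemma mat_adjoint_one [simp]: "mat_adjoint (1\<^sub>m n :: complex mat) = 1\<^sub>m n"
  by (rule eq_matI) auto

lemma mat_adjoint_zero [simp]: "mat_adjoint (0\<^sub>m n m :: complex mat) = 0\<^sub>m m n"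
  by (rule eq_matI) auto

lemma euclid_norm_nonneg [simp]: "euclid_norm v \<ge> 0"
  by (simp add: euclid_norm_def)

lemma euclid_norm_col_sq:
  assumes "M \<in> carrier_mat n m" "j < m"
  shows "(euclid_norm (col M j))\<^sup>2 = (\<Sum>k<n. (cmod (M $$ (k, j)))\<^sup>2)"
  using assms by (auto simp: euclid_norm_def L2_set_def sum_nonneg)

text \<open>Column norms appear as diagonal entries of the Gram matrix. This is how singular values, unit
  columns of unitary matrices and isometry of unitary matrices are read off below.\<close>

lemma adjoint_mult_diag:
  assumes M: "M \<in> carrier_mat n m" and j: "j < m"
  shows "(mat_adjoint M * M) $$ (j, j) = of_real ((euclid_norm (col M j))\<^sup>2)"
proof -
  have "(mat_adjoint M * M) $$ (j, j) = (\<Sum>k<n. cnj (M $$ (k, j)) * M $$ (k, j))"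
    using M j by (subst mat_mult_index_sum[of _ m n _ m]) auto
  also have "\<dots> = of_real ((euclid_norm (col M j))\<^sup>2)"
    unfolding euclid_norm_col_sq[OF M j] of_real_sum
    by (intro sum.cong refl) (simp only: complex_norm_square mult.commute)
  finally show ?thesis .
qed

lemma cmod_adjoint_mult_le:
  assumes M: "M \<in> carrier_mat n m" and N: "N \<in> carrier_mat n k" and "i < m" "j < k"
  shows "cmod ((mat_adjoint M * N) $$ (i, j)) \<le> euclid_norm (col M i) * euclid_norm (col N j)"
proof -
  have "(mat_adjoint M * N) $$ (i, j) = (\<Sum>l<n. cnj (M $$ (l, i)) * N $$ (l, j))"
    using assms by (subst mat_mult_index_sum[of _ m n _ k]) auto
  also have "cmod \<dots> \<le> (\<Sum>l<n. \<bar>cmod (M $$ (l, i))\<bar> * \<bar>cmod (N $$ (l, j))\<bar>)"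
    by (rule order.trans[OF norm_sum]) (simp add: norm_mult)
  also have "\<dots> \<le> L2_set (\<lambda>l. cmod (M $$ (l, i))) {..<n} * L2_set (\<lambda>l. cmod (N $$ (l, j))) {..<n}"
    by (rule L2_set_mult_ineq)
  also have "\<dots> = euclid_norm (col M i) * euclid_norm (col N j)"
    unfolding euclid_norm_def using assms
    by (intro arg_cong2[where f = "(*)"] L2_set_cong) auto
  finally show ?thesis .
qed

section \<open>Unitary triangularisation\<close>

definition unitary :: "nat \<Rightarrow> complex mat \<Rightarrow> bool" where
  "unitary n P \<longleftrightarrow> P \<in> carrier_mat n n \<and> mat_adjoint P * P = 1\<^sub>m n"

lemma unitaryD:
  assumes "unitary n P"
  shows "P \<in> carrier_mat n n" "mat_adjoint P \<in> carrier_mat n n"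
    "mat_adjoint P * P = 1\<^sub>m n" "P * mat_adjoint P = 1\<^sub>m n"
proof -
  show P: "P \<in> carrier_mat n n" and P': "mat_adjoint P \<in> carrier_mat n n"
    and PP: "mat_adjoint P * P = 1\<^sub>m n"
    using assms by (auto simp: unitary_def)
  show "P * mat_adjoint P = 1\<^sub>m n"
    by (rule mat_mult_left_right_inverse[OF P' P PP])
qed

lemma unitary_mult:
  assumes P: "unitary n P" and Q: "unitary n Q"
  shows "unitary n (P * Q)"
proof -
  note p = unitaryD[OF P] and q = unitaryD[OF Q]
  have "mat_adjoint (P * Q) * (P * Q) = mat_adjoint Q * (mat_adjoint P * P) * Q"
    using p(1,2) q(1,2) by (simp add: mat_adjoint_mult[of _ n n _ n] assoc_mult_mat[of _ n n _ n _ n])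
  also have "\<dots> = 1\<^sub>m n" using p q by simp
  finally show ?thesis using p q by (auto simp: unitary_def)
qed

text \<open>Complete \<open>v\<close> to a basis, orthogonalise, and divide each column by its norm. The scalar \<open>c\<close> is the
  reciprocal of the norm of \<open>v\<close>; only the direction of the first column matters for deflation.\<close>

lemma unitary_first_column:
  fixes v :: "complex vec"
  assumes v: "v \<in> carrier_vec n" and v0: "v \<noteq> 0\<^sub>v n"
  obtains W c where "unitary n W" "col W 0 = c \<cdot>\<^sub>v v" "n > 0"
proof -
  interpret cof_vec_space n "TYPE(complex)" .
  define b where "b = basis_completion v"
  from basis_completion[OF v v0, folded b_def]
  have dist_b: "distinct b" and indep: "\<not> lin_dep (set b)" and b: "set b \<subseteq> carrier_vec n"
    and hdb: "hd b = v" and len_b: "length b = n" by auto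
  have n: "n > 0" using v v0 by (cases "n = 0") auto
  with hdb len_b obtain vs where bv: "b = v # vs" by (cases b) auto
  define ws where "ws = gram_schmidt n b"
  from gram_schmidt_result[OF b dist_b indep refl, folded ws_def]
  have ws: "set ws \<subseteq> carrier_vec n" "corthogonal ws" "length ws = n"
    by (auto simp: len_b)
  have "hd ws = v" using gram_schmidt_hd[OF v, of vs] by (simp add: ws_def bv)
  hence ws0: "ws ! 0 = v" using ws(3) n by (cases ws) auto
  define M where "M = mat_of_cols n ws"
  have M: "M \<in> carrier_mat n n" using ws(3) by (auto simp: M_def)
  have colM: "col M j = ws ! j" if "j < n" for j
    using that ws unfolding M_def by (intro col_mat_of_cols) auto
  have wsc: "ws ! j \<in> carrier_vec n" if "j < n" for j using that ws by auto
  have MM: "(mat_adjoint M * M) $$ (i, j) = ws ! j \<bullet>c (ws ! i)" if "i < n" "j < n" for i j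
  proof -
    have "(mat_adjoint M * M) $$ (i, j) = (\<Sum>l<n. cnj (M $$ (l, i)) * M $$ (l, j))"
      using M that by (subst mat_mult_index_sum[of _ n n _ n]) auto
    also have "\<dots> = (\<Sum>l<n. vec_index (ws ! j) l * cnj (vec_index (ws ! i) l))"
      using M that colM[of i, symmetric] colM[of j, symmetric] by (intro sum.cong) auto
    also have "\<dots> = ws ! j \<bullet>c (ws ! i)"
      using wsc[OF that(1)] wsc[OF that(2)] unfolding scalar_prod_def
      by (auto simp: atLeast0LessThan conjugate_complex_def intro!: sum.cong)
    finally show ?thesis .
  qed
  define d where "d j = euclid_norm (col M j)" for j
  \<comment> \<open>The Gram matrix of an orthogonal family has a nonzero diagonal, so one may divide by \<open>d\<close>.\<close>
  have d: "d j \<noteq> 0" if "j < n" for j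
    using adjoint_mult_diag[OF M that] MM[OF that that] corthogonalD[OF ws(2), of j j] that ws(3)
    by (auto simp: d_def)
  define W where "W = mat n n (\<lambda>(i, j). of_real (1 / d j) * M $$ (i, j))"
  have W: "W \<in> carrier_mat n n" by (simp add: W_def)
  have "mat_adjoint W * W = 1\<^sub>m n"
  proof (rule eq_matI)
    fix i j assume "i < dim_row (1\<^sub>m n)" "j < dim_col (1\<^sub>m n)"
    hence ij: "i < n" "j < n" by auto
    have "(mat_adjoint W * W) $$ (i, j) = (\<Sum>l<n. cnj (W $$ (l, i)) * W $$ (l, j))"
      using W ij by (subst mat_mult_index_sum[of _ n n _ n]) auto
    also have "\<dots> = of_real (1 / d i * (1 / d j)) * (\<Sum>l<n. cnj (M $$ (l, i)) * M $$ (l, j))"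
      unfolding sum_distrib_left using ij by (intro sum.cong) (auto simp: W_def)
    also have "(\<Sum>l<n. cnj (M $$ (l, i)) * M $$ (l, j)) = (mat_adjoint M * M) $$ (i, j)"
      using M ij by (subst mat_mult_index_sum[of _ n n _ n]) auto
    also have "of_real (1 / d i * (1 / d j)) * \<dots> = (1\<^sub>m n) $$ (i, j)"
    proof (cases "i = j")
      case True
      have "of_real (1 / d j * (1 / d j)) * complex_of_real ((d j)\<^sup>2) = 1"
        using d[OF ij(2)] by (simp add: power2_eq_square)
      thus ?thesis using True ij adjoint_mult_diag[OF M ij(2)] by (simp add: d_def)
    next
      case False
      thus ?thesis using ij MM[OF ij] corthogonalD[OF ws(2), of j i] ws(3) by simp
    qed
    finally show "(mat_adjoint W * W) $$ (i, j) = (1\<^sub>m n) $$ (i, j)" .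
  qed (use W in auto)
  hence "unitary n W" using W by (simp add: unitary_def)
  moreover have "col W 0 = of_real (1 / d 0) \<cdot>\<^sub>v v"
    using n v M by (intro eq_vecI) (auto simp: W_def ws0[symmetric] colM[symmetric])
  ultimately show ?thesis using n that by blast
qed

text \<open>Deflation: a unitary \<open>W\<close> whose first column is an eigenvector brings \<open>A\<close> into block triangular form
  with the eigenvalue \<open>e\<close> in the corner, and the induction hypothesis triangularises the remaining
  block. Unitarity, and not just similarity, is essential later: it makes the diagonal of \<open>P\<^sup>* C P\<close>
  small when the trace norm of \<open>C\<close> is small, and the diagonal of \<open>P\<^sup>* B P\<close> real when \<open>B\<close> is Hermitian.\<close>

theorem unitary_schur_decomposition:
  fixes A :: "complex mat"
  assumes "A \<in> carrier_mat n n" and "char_poly A = (\<Prod>e\<leftarrow>es. [:- e, 1:])"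
  shows "\<exists>P. unitary n P \<and> upper_triangular (mat_adjoint P * A * P)
    \<and> diag_mat (mat_adjoint P * A * P) = es"
  using assms
proof (induction es arbitrary: n A)
  case Nil
  with degree_monic_char_poly[of A n] have "n = 0" by auto
  thus ?case using Nil by (intro exI[of _ "1\<^sub>m 0"]) (auto simp: unitary_def diag_mat_def)
next
  case (Cons e es n A)
  note A = Cons.prems(1)
  have "poly (char_poly A) e = 0" unfolding Cons.prems(2) by simp
  hence "eigenvalue A e" unfolding eigenvalue_root_char_poly[OF A] .
  then obtain v where v: "v \<in> carrier_vec n" "v \<noteq> 0\<^sub>v n" and Av: "A *\<^sub>v v = e \<cdot>\<^sub>v v"
    using A by (auto simp: eigenvalue_def eigenvector_def)
  obtain W c where W: "unitary n W" and colW: "col W 0 = c \<cdot>\<^sub>v v" and n: "n > 0"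
    by (rule unitary_first_column[OF v])
  note w = unitaryD[OF W]
  define m where "m = n - 1"
  have nm: "n = 1 + m" using n by (simp add: m_def)
  define A' where "A' = mat_adjoint W * A * W"
  have A': "A' \<in> carrier_mat n n" using A w by (simp add: A'_def)
  have col0: "col A' 0 = e \<cdot>\<^sub>v unit_vec n 0"
  proof -
    have "col A' 0 = (mat_adjoint W * A) *\<^sub>v col W 0"
      unfolding A'_def using A w n by (intro col_mult2[of _ n n _ n]) auto
    also have "\<dots> = mat_adjoint W *\<^sub>v (A *\<^sub>v (c \<cdot>\<^sub>v v))"
      unfolding colW using A w v by (intro assoc_mult_mat_vec[of _ n n _ n]) auto
    also have "A *\<^sub>v (c \<cdot>\<^sub>v v) = e \<cdot>\<^sub>v col W 0"
      unfolding colW using A v Av by (simp add: mult_mat_vec[of _ n n] smult_smult_assoc mult.commute)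
    also have "mat_adjoint W *\<^sub>v \<dots> = e \<cdot>\<^sub>v (mat_adjoint W *\<^sub>v col W 0)"
      using w by (intro mult_mat_vec[of _ n n]) auto
    also have "mat_adjoint W *\<^sub>v col W 0 = col (mat_adjoint W * W) 0"
      using w n by (intro col_mult2[symmetric, of _ n n _ n]) auto
    also have "\<dots> = unit_vec n 0" using w n by simp
    finally show ?thesis .
  qed
  obtain A1 A2 A0 A3 where split: "split_block A' 1 1 = (A1, A2, A0, A3)"
    by (cases "split_block A' 1 1") auto
  have blk: "A1 \<in> carrier_mat 1 1" "A2 \<in> carrier_mat 1 m" "A0 \<in> carrier_mat m 1"
    "A3 \<in> carrier_mat m m" "A' = four_block_mat A1 A2 A0 A3"
    using split_block[OF split, of m m] A' nm by auto
  have A'0: "A' $$ (i, 0) = (if i = 0 then e else 0)" if "i < n" for i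
  proof -
    have "A' $$ (i, 0) = vec_index (col A' 0) i" using that A' by auto
    thus ?thesis unfolding col0 using that by (auto simp: unit_vec_def)
  qed
  have A1: "A1 = mat 1 1 (\<lambda>_. e)"
    using split A' A'0[of 0] n by (auto simp: split_block_def Let_def)
  have A0: "A0 = 0\<^sub>m m 1"
    using split A' A'0 nm by (auto simp: split_block_def Let_def)
  have "similar_mat_wit A' A (mat_adjoint W) W"
    by (rule similar_mat_witI[of _ _ n]) (use A A' w in \<open>auto simp: A'_def\<close>)
  hence "char_poly A' = char_poly A" by (intro char_poly_similar) (auto simp: similar_mat_def)
  also have "char_poly A' = char_poly A1 * char_poly A3"
    unfolding blk(5) A0 by (rule char_poly_four_block_zeros_col[OF blk(1,2,4)])
  also have "char_poly A1 = [:- e, 1:]"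
    by (subst char_poly_upper_triangular[OF blk(1)]) (auto simp: A1 diag_mat_def)
  finally have "[:- e, 1:] * char_poly A3 = [:- e, 1:] * (\<Prod>e\<leftarrow>es. [:- e, 1:])"
    using Cons.prems(2) by simp
  hence "char_poly A3 = (\<Prod>e\<leftarrow>es. [:- e, 1:])"
    by (metis mult_cancel_left pCons_eq_0_iff zero_neq_one)
  from Cons.IH[OF blk(4) this] obtain P where P: "unitary m P"
    and ut: "upper_triangular (mat_adjoint P * A3 * P)"
    and dg: "diag_mat (mat_adjoint P * A3 * P) = es" by blast
  note p = unitaryD[OF P]
  define F where "F = four_block_mat (1\<^sub>m 1) (0\<^sub>m 1 m) (0\<^sub>m m 1) P"
  have F: "F \<in> carrier_mat n n" using p nm by (auto simp: F_def)
  have F': "mat_adjoint F = four_block_mat (1\<^sub>m 1) (0\<^sub>m 1 m) (0\<^sub>m m 1) (mat_adjoint P)"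
    unfolding F_def by (subst mat_adjoint_four_block[of _ 1 1 _ m _ m]) (use p in auto)
  have "mat_adjoint F * F = four_block_mat (1\<^sub>m 1) (0\<^sub>m 1 m) (0\<^sub>m m 1) (1\<^sub>m m)"
    unfolding F' unfolding F_def
    by (subst mult_four_block_mat[of _ 1 1 _ m _ m _ _ 1 _ m]) (use p in auto)
  also have "\<dots> = 1\<^sub>m n" unfolding nm by (rule eq_matI) auto
  finally have uF: "unitary n F" using F by (simp add: unitary_def)
  have "mat_adjoint F * A' * F = four_block_mat A1 (A2 * P) (0\<^sub>m m 1) (mat_adjoint P * A3 * P)"
    unfolding F' unfolding F_def blk(5) A0
    apply (subst mult_four_block_mat[of _ 1 1 _ m _ m _ _ 1 _ m])
    using p blk apply auto[8]
    apply (subst mult_four_block_mat[of _ 1 1 _ m _ m _ _ 1 _ m])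
    using p blk by auto
  moreover have "mat_adjoint (W * F) * A * (W * F) = mat_adjoint F * A' * F"
    unfolding A'_def using w F A
    by (simp add: mat_adjoint_mult[of _ n n _ n] assoc_mult_mat[of _ n n _ n _ n])
  ultimately have eq: "mat_adjoint (W * F) * A * (W * F) =
    four_block_mat A1 (A2 * P) (0\<^sub>m m 1) (mat_adjoint P * A3 * P)" by simp
  have "upper_triangular (mat_adjoint (W * F) * A * (W * F))"
    unfolding eq
    by (intro upper_triangular_four_block[OF _ _ _ ut]) (use p blk in \<open>auto simp: A1\<close>)
  moreover have "diag_mat (mat_adjoint (W * F) * A * (W * F)) = e # es"
    unfolding eq using p blk dg
    by (subst diag_four_block_mat[of _ 1 _ m]) (auto simp: A1 diag_mat_def)
  ultimately show ?case using unitary_mult[OF W uF] by blast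
qed

text \<open>The form in which triangularisation is used: the multiset of eigenvalues, with multiplicities,
  is indexed by the diagonal of the conjugated matrix.\<close>

lemma eigenvalues_schur:
  assumes A: "A \<in> carrier_mat n n"
  obtains P where "unitary n P" "upper_triangular (mat_adjoint P * A * P)"
    "eigenvalues A = {# (mat_adjoint P * A * P) $$ (i, i). i \<in># mset_set {..<n} #}"
proof -
  obtain es where es: "char_poly A = (\<Prod>e\<leftarrow>es. [:- e, 1:])"
    using char_poly_factorized[OF A] by blast
  have "proots (\<Prod>e\<leftarrow>es. [:- e, 1:]) = mset es"
  proof (induction es)
    case (Cons e es)
    have "(\<Prod>e\<leftarrow>es. [:- e, 1:]) \<noteq> (0 :: complex poly)" by (auto simp: prod_list_zero_iff)
    hence "proots ([:- e, 1:] * (\<Prod>e\<leftarrow>es. [:- e, 1:])) = {#e#} + mset es"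
      using Cons by (subst proots_mult) auto
    thus ?case by simp
  qed auto
  hence eig: "eigenvalues A = mset es" by (simp add: eigenvalues_def es)
  from unitary_schur_decomposition[OF A es] obtain P where P: "unitary n P"
    "upper_triangular (mat_adjoint P * A * P)" "diag_mat (mat_adjoint P * A * P) = es" by blast
  have "dim_row (mat_adjoint P * A * P) = n" using unitaryD[OF P(1)] by auto
  hence "eigenvalues A = {# (mat_adjoint P * A * P) $$ (i, i). i \<in># mset_set {..<n} #}"
    unfolding eig P(3)[symmetric] diag_mat_def by (simp add: atLeast0LessThan)
  thus ?thesis using P that by blast
qed

lemma size_eigenvalues: "A \<in> carrier_mat n n \<Longrightarrow> size (eigenvalues A) = n"
  unfolding eigenvalues_def size_proots_complex by (simp add: degree_monic_char_poly)

section \<open>Operator norm bounds\<close>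

text \<open>An upper bound for the operator norm, stated pointwise: bounds compose, add and pass to powers
  without supremum arguments.\<close>

definition op_bound :: "complex mat \<Rightarrow> real \<Rightarrow> bool" where
  "op_bound A M \<longleftrightarrow> (\<forall>v \<in> carrier_vec (dim_col A). euclid_norm (A *\<^sub>v v) \<le> M * euclid_norm v)"

lemma op_boundD: "op_bound A M \<Longrightarrow> v \<in> carrier_vec (dim_col A) \<Longrightarrow>
    euclid_norm (A *\<^sub>v v) \<le> M * euclid_norm v"
  by (simp add: op_bound_def)

lemma op_bound_mono: "op_bound A M \<Longrightarrow> M \<le> M' \<Longrightarrow> op_bound A M'"
  unfolding op_bound_def by (meson euclid_norm_nonneg mult_right_mono order.trans)

lemma op_bound_mult:
  assumes A: "A \<in> carrier_mat n m" and B: "B \<in> carrier_mat m k"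
    and M: "op_bound A M" and N: "op_bound B N" and "M \<ge> 0"
  shows "op_bound (A * B) (M * N)"
  unfolding op_bound_def
proof
  fix v :: "complex Matrix.vec" assume "v \<in> carrier_vec (dim_col (A * B))"
  hence v: "v \<in> carrier_vec k" using B by simp
  have "euclid_norm (A * B *\<^sub>v v) = euclid_norm (A *\<^sub>v (B *\<^sub>v v))"
    using A B v by (simp add: assoc_mult_mat_vec[of _ n m _ k])
  also have "\<dots> \<le> M * euclid_norm (B *\<^sub>v v)"
    using A B v by (intro op_boundD[OF M]) auto
  also have "\<dots> \<le> M * (N * euclid_norm v)"
    using B v \<open>M \<ge> 0\<close> by (intro mult_left_mono op_boundD[OF N]) auto
  finally show "euclid_norm (A * B *\<^sub>v v) \<le> M * N * euclid_norm v" by (simp add: mult.assoc)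
qed

lemma euclid_norm_add:
  assumes "v \<in> carrier_vec n" "w \<in> carrier_vec n"
  shows "euclid_norm (v + w) \<le> euclid_norm v + euclid_norm w"
proof -
  have "euclid_norm (v + w) \<le> L2_set (\<lambda>i. cmod (vec_index v i) + cmod (vec_index w i)) {..<n}"
    unfolding euclid_norm_def using assms by (auto intro!: L2_set_mono norm_triangle_ineq)
  also have "\<dots> \<le> euclid_norm v + euclid_norm w"
    using assms L2_set_triangle_ineq by (auto simp: euclid_norm_def)
  finally show ?thesis .
qed

lemma euclid_norm_smult: "euclid_norm (c \<cdot>\<^sub>v v) = cmod c * euclid_norm v"
  by (simp add: euclid_norm_def L2_set_right_distrib norm_mult cong: L2_set_cong_simp)

lemma op_bound_add:
  assumes A: "A \<in> carrier_mat n m" and B: "B \<in> carrier_mat n m"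
    and M: "op_bound A M" and N: "op_bound B N"
  shows "op_bound (A + B) (M + N)"
  unfolding op_bound_def
proof
  fix v :: "complex Matrix.vec" assume "v \<in> carrier_vec (dim_col (A + B))"
  hence v: "v \<in> carrier_vec m" using B by simp
  have "euclid_norm ((A + B) *\<^sub>v v) \<le> euclid_norm (A *\<^sub>v v) + euclid_norm (B *\<^sub>v v)"
    using A B v by (simp add: add_mult_distrib_mat_vec[of _ n m] euclid_norm_add[of _ n])
  also have "\<dots> \<le> M * euclid_norm v + N * euclid_norm v"
    using A B v by (intro add_mono op_boundD[OF M] op_boundD[OF N]) auto
  finally show "euclid_norm ((A + B) *\<^sub>v v) \<le> (M + N) * euclid_norm v"
    by (simp add: distrib_right)
qed

text \<open>\<open>v\<close> is regarded as an \<open>n \<times> 1\<close> matrix, whose \<open>1 \<times> 1\<close> Gram matrix is invariant under \<open>P\<close>.\<close>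

lemma op_bound_unitary:
  assumes "unitary n P"
  shows "op_bound P 1"
  unfolding op_bound_def
proof
  note p = unitaryD[OF assms]
  fix v :: "complex Matrix.vec" assume "v \<in> carrier_vec (dim_col P)"
  hence v: "v \<in> carrier_vec n" using p by simp
  define V where "V = mat_of_cols n [v]"
  have V: "V \<in> carrier_mat n 1" by (auto simp: V_def)
  have cV: "col V 0 = v" using v by (simp add: V_def)
  have PV: "P * V \<in> carrier_mat n 1" using p V by auto
  have "mat_adjoint (P * V) * (P * V) = mat_adjoint V * (mat_adjoint P * P) * V"
    using p(1,2) V by (simp add: mat_adjoint_mult[of _ n n _ 1] assoc_mult_mat[of _ 1 n _ n _ 1]
        assoc_mult_mat[of _ n n _ n _ 1])
  also have "\<dots> = mat_adjoint V * V" using p V by simp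
  finally have "(euclid_norm (col (P * V) 0))\<^sup>2 = (euclid_norm (col V 0))\<^sup>2"
    using adjoint_mult_diag[OF PV, of 0] adjoint_mult_diag[OF V, of 0]
    by (simp only: of_real_eq_iff less_one)
  moreover have "col (P * V) 0 = P *\<^sub>v v"
    using p V cV by (subst col_mult2[of _ n n _ 1]) auto
  ultimately have "(euclid_norm (P *\<^sub>v v))\<^sup>2 = (euclid_norm v)\<^sup>2" by (simp add: cV)
  thus "euclid_norm (P *\<^sub>v v) \<le> 1 * euclid_norm v" by (auto simp: power2_eq_iff_nonneg)
qed

lemma unitary_adjoint: "unitary n P \<Longrightarrow> unitary n (mat_adjoint P)"
proof -
  assume P: "unitary n P"
  note p = unitaryD[OF P]
  have "mat_adjoint (mat_adjoint P) = P" by (rule eq_matI) auto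
  thus ?thesis using p by (simp add: unitary_def)
qed

lemma op_bound_pow:
  assumes A: "A \<in> carrier_mat n n" and M: "op_bound A M" "M \<ge> 0"
  shows "op_bound (A ^\<^sub>m k) (M ^ k)"
proof (induction k)
  case 0
  have "unitary n (1\<^sub>m n)" by (simp add: unitary_def)
  thus ?case using A op_bound_unitary by auto
next
  case (Suc k)
  have "op_bound (A ^\<^sub>m k * A) (M ^ k * M)"
    using A M by (intro op_bound_mult[OF _ _ Suc]) auto
  thus ?case by (simp add: mult.commute)
qed

lemma cmod_vec_index_le_euclid_norm:
  "i < dim_vec v \<Longrightarrow> cmod (vec_index v i) \<le> euclid_norm v"
  unfolding euclid_norm_def
  using member_le_L2_set[of "{..<dim_vec v}" i "\<lambda>i. cmod (vec_index v i)"] by simp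

text \<open>A crude bound whose only purpose is to show that the supremum defining the spectral norm is
  over a bounded set.\<close>

lemma euclid_norm_mult_le_sum:
  assumes v: "v \<in> carrier_vec (dim_col A)"
  shows "euclid_norm (A *\<^sub>v v) \<le>
    (\<Sum>i<dim_row A. \<Sum>j<dim_col A. cmod (A $$ (i, j))) * euclid_norm v"
proof -
  have "euclid_norm (A *\<^sub>v v) \<le> (\<Sum>i<dim_row A. cmod (vec_index (A *\<^sub>v v) i))"
    unfolding euclid_norm_def by (intro order.trans[OF L2_set_le_sum]) auto
  also have "\<dots> \<le> (\<Sum>i<dim_row A. \<Sum>j<dim_col A. cmod (A $$ (i, j)) * euclid_norm v)"
  proof (intro sum_mono)
    fix i assume i: "i \<in> {..<dim_row A}"
    have "vec_index (A *\<^sub>v v) i = (\<Sum>j<dim_col A. A $$ (i, j) * vec_index v j)"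
      using i v by (auto simp: scalar_prod_def atLeast0LessThan intro!: sum.cong)
    also have "cmod \<dots> \<le> (\<Sum>j<dim_col A. cmod (A $$ (i, j)) * euclid_norm v)"
      using v by (intro order.trans[OF norm_sum] sum_mono)
        (auto simp: norm_mult intro!: mult_left_mono cmod_vec_index_le_euclid_norm)
    finally show "cmod (vec_index (A *\<^sub>v v) i) \<le> (\<Sum>j<dim_col A. cmod (A $$ (i, j)) * euclid_norm v)" .
  qed
  finally show ?thesis by (simp add: sum_distrib_right)
qed

lemma op_bound_spectral_norm: "op_bound A (spectral_norm A)"
  unfolding op_bound_def
proof
  fix v :: "complex Matrix.vec" assume v: "v \<in> carrier_vec (dim_col A)"
  define s where "s = (\<Sum>i<dim_row A. \<Sum>j<dim_col A. cmod (A $$ (i, j)))"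
  have s: "s \<ge> 0" by (auto simp: s_def intro!: sum_nonneg)
  have bdd: "bdd_above ((\<lambda>v. euclid_norm (A *\<^sub>v v)) `
      {v \<in> carrier_vec (dim_col A). euclid_norm v \<le> 1})"
  proof (rule bdd_aboveI2[of _ _ s])
    fix w :: "complex Matrix.vec" assume "w \<in> {v \<in> carrier_vec (dim_col A). euclid_norm v \<le> 1}"
    thus "euclid_norm (A *\<^sub>v w) \<le> s"
      using euclid_norm_mult_le_sum[of w A] mult_left_mono[OF _ s, of "euclid_norm w" 1]
      by (auto simp: s_def)
  qed
  show "euclid_norm (A *\<^sub>v v) \<le> spectral_norm A * euclid_norm v"
  proof (cases "euclid_norm v = 0")
    case True
    thus ?thesis using euclid_norm_mult_le_sum[OF v] by simp
  next
    case False
    define c where "c = complex_of_real (1 / euclid_norm v)"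
    have c: "cmod c = 1 / euclid_norm v" by (simp add: c_def norm_divide)
    have "euclid_norm (A *\<^sub>v (c \<cdot>\<^sub>v v)) \<le> spectral_norm A"
      unfolding spectral_norm_def using v False
      by (intro cSUP_upper[OF _ bdd]) (auto simp: euclid_norm_smult c)
    also have "A *\<^sub>v (c \<cdot>\<^sub>v v) = c \<cdot>\<^sub>v (A *\<^sub>v v)"
      using v by (intro mult_mat_vec[of _ "dim_row A" "dim_col A"]) auto
    finally have "euclid_norm (A *\<^sub>v v) / euclid_norm v \<le> spectral_norm A"
      by (simp add: euclid_norm_smult c)
    thus ?thesis using False by (simp add: divide_le_eq order_less_le)
  qed
qed

section \<open>Traces and the trace norm\<close>

definition mtrace :: "complex mat \<Rightarrow> complex" where
  "mtrace A = (\<Sum>i<dim_row A. A $$ (i, i))"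

lemma mtrace_comm:
  assumes A: "A \<in> carrier_mat n m" and B: "B \<in> carrier_mat m n"
  shows "mtrace (A * B) = mtrace (B * A)"
proof -
  have "mtrace (A * B) = (\<Sum>i<n. \<Sum>l<m. A $$ (i, l) * B $$ (l, i))"
    unfolding mtrace_def using A by (auto simp: mat_mult_index_sum[OF A B] simp del: index_mult_mat(1))
  also have "\<dots> = (\<Sum>l<m. \<Sum>i<n. B $$ (l, i) * A $$ (i, l))"
    by (subst sum.swap) (simp add: mult.commute)
  also have "\<dots> = mtrace (B * A)"
    unfolding mtrace_def using B by (auto simp: mat_mult_index_sum[OF B A] simp del: index_mult_mat(1))
  finally show ?thesis .
qed

lemma mtrace_add:
  assumes "A \<in> carrier_mat n n" "B \<in> carrier_mat n n"
  shows "mtrace (A + B) = mtrace A + mtrace B"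
  using assms by (simp add: mtrace_def sum.distrib)

lemma euclid_norm_col_unitary:
  assumes P: "unitary n P" and i: "i < n"
  shows "euclid_norm (col P i) = 1"
proof -
  have "complex_of_real ((euclid_norm (col P i))\<^sup>2) = 1"
    using adjoint_mult_diag[OF unitaryD(1)[OF P] i] unitaryD(3)[OF P] i by simp
  hence "(euclid_norm (col P i))\<^sup>2 = 1\<^sup>2" by (simp only: of_real_eq_1_iff one_power2)
  thus ?thesis by (simp only: power2_eq_iff_nonneg euclid_norm_nonneg zero_le_one)
qed

text \<open>Duality of operator norm and trace norm. Take a unitary \<open>V\<close> triangularising \<open>C\<^sup>* C\<close>. The \<open>i\<close>-th diagonal
  entry of \<open>V\<^sup>* C\<^sup>* C V\<close> is the squared norm of \<open>C v\<^sub>i\<close>, so the singular values of \<open>C\<close> are the norms of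
  the \<open>C v\<^sub>i\<close>. Computing the trace of \<open>X C\<close> in the orthonormal basis \<open>v\<^sub>i\<close> and applying the
  Cauchy-Schwarz inequality to each term gives the claim.\<close>

theorem cmod_mtrace_mult_le:
  assumes X: "X \<in> carrier_mat n n" and C: "C \<in> carrier_mat n n" and M: "op_bound X M"
  shows "cmod (mtrace (X * C)) \<le> M * trace_norm C"
proof -
  have CC: "mat_adjoint C * C \<in> carrier_mat n n" using C by simp
  obtain V where V: "unitary n V"
    and eig: "eigenvalues (mat_adjoint C * C) =
      {# (mat_adjoint V * (mat_adjoint C * C) * V) $$ (i, i). i \<in># mset_set {..<n} #}"
    by (rule eigenvalues_schur[OF CC])
  note v = unitaryD[OF V]
  have CV: "C * V \<in> carrier_mat n n" using C v by simp
  have gram: "mat_adjoint V * (mat_adjoint C * C) * V = mat_adjoint (C * V) * (C * V)"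
    using C v(1,2) by (simp add: mat_adjoint_mult[of _ n n _ n] assoc_mult_mat[of _ n n _ n _ n])
  have "eigenvalues (mat_adjoint C * C) =
      {# complex_of_real ((euclid_norm (col (C * V) i))\<^sup>2). i \<in># mset_set {..<n} #}"
    unfolding eig gram by (intro image_mset_cong adjoint_mult_diag[OF CV]) simp
  hence tn: "trace_norm C = (\<Sum>i<n. euclid_norm (col (C * V) i))"
    by (simp add: trace_norm_def singular_values_def image_mset.compositionality o_def
        sum_unfold_sum_mset)
  have XCV: "X * (C * V) \<in> carrier_mat n n" using X CV by simp
  have "X * C = (X * (C * V)) * mat_adjoint V"
    using X C v by (simp add: assoc_mult_mat[of _ n n _ n _ n])
  hence "mtrace (X * C) = mtrace (mat_adjoint V * (X * (C * V)))"
    using mtrace_comm[OF XCV v(2)] by simp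
  also have "cmod \<dots> \<le> (\<Sum>i<n. cmod ((mat_adjoint V * (X * (C * V))) $$ (i, i)))"
    unfolding mtrace_def using v(1) by (simp add: norm_sum del: index_mult_mat(1))
  also have "\<dots> \<le> (\<Sum>i<n. M * euclid_norm (col (C * V) i))"
  proof (rule sum_mono)
    fix i assume "i \<in> {..<n}"
    hence i: "i < n" by simp
    have "cmod ((mat_adjoint V * (X * (C * V))) $$ (i, i)) \<le>
        euclid_norm (col V i) * euclid_norm (col (X * (C * V)) i)"
      by (rule cmod_adjoint_mult_le[OF v(1) XCV i i])
    also have "\<dots> = euclid_norm (X *\<^sub>v col (C * V) i)"
      unfolding euclid_norm_col_unitary[OF V i] using X CV i by (subst col_mult2) auto
    also have "\<dots> \<le> M * euclid_norm (col (C * V) i)"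
      using X C by (intro op_boundD[OF M]) (auto intro!: carrier_vecI)
    finally show "cmod ((mat_adjoint V * (X * (C * V))) $$ (i, i)) \<le> M * euclid_norm (col (C * V) i)" .
  qed
  finally show ?thesis by (simp add: tn sum_distrib_left)
qed

section \<open>Spectrum of a perturbed Hermitian matrix\<close>

lemma eigenvalue_le_op_bound:
  assumes A: "A \<in> carrier_mat n n" and M: "op_bound A M" and z: "z \<in># eigenvalues A"
  shows "cmod z \<le> M"
proof -
  obtain P where P: "unitary n P"
    and eig: "eigenvalues A = {# (mat_adjoint P * A * P) $$ (i, i). i \<in># mset_set {..<n} #}"
    by (rule eigenvalues_schur[OF A])
  note p = unitaryD[OF P]
  obtain i where i: "i < n" and zi: "z = (mat_adjoint P * A * P) $$ (i, i)"
    using z unfolding eig by auto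
  have AP: "A * P \<in> carrier_mat n n" using A p by simp
  have "z = (mat_adjoint P * (A * P)) $$ (i, i)"
    unfolding zi using A p by (simp only: assoc_mult_mat[of _ n n _ n _ n])
  also have "cmod \<dots> \<le> euclid_norm (col P i) * euclid_norm (col (A * P) i)"
    by (rule cmod_adjoint_mult_le[OF p(1) AP i i])
  also have "\<dots> = euclid_norm (A *\<^sub>v col P i)"
    unfolding euclid_norm_col_unitary[OF P i] using A p i by (subst col_mult2) auto
  also have "\<dots> \<le> M * euclid_norm (col P i)"
    using A p by (intro op_boundD[OF M]) (auto intro!: carrier_vecI)
  finally show ?thesis using euclid_norm_col_unitary[OF P i] by simp
qed

lemma hermitian_conjugation_diag_real:
  assumes B: "B \<in> carrier_mat n n" "hermitian_mat B" and P: "P \<in> carrier_mat n n" and i: "i < n"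
  shows "Im ((mat_adjoint P * B * P) $$ (i, i)) = 0"
proof -
  have P': "mat_adjoint (mat_adjoint P) = P" by (rule eq_matI) auto
  have "mat_adjoint (mat_adjoint P * B * P) = mat_adjoint P * B * P"
    using B P P' by (simp add: hermitian_mat_def mat_adjoint_mult[of _ n n _ n] assoc_mult_mat[of _ n n _ n _ n])
  hence "cnj ((mat_adjoint P * B * P) $$ (i, i)) = (mat_adjoint P * B * P) $$ (i, i)"
    using mat_adjoint_index[of i "mat_adjoint P * B * P" i] P i by (simp del: index_mult_mat(1))
  from arg_cong[OF this, of Im] show ?thesis unfolding cnj.sel by linarith
qed

lemma hermitian_eigenvalues_real:
  assumes B: "B \<in> carrier_mat n n" "hermitian_mat B" and z: "z \<in># eigenvalues B"
  shows "Im z = 0"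
proof -
  obtain P where P: "unitary n P"
    and eig: "eigenvalues B = {# (mat_adjoint P * B * P) $$ (i, i). i \<in># mset_set {..<n} #}"
    by (rule eigenvalues_schur[OF B(1)])
  obtain i where i: "i < n" and zi: "z = (mat_adjoint P * B * P) $$ (i, i)"
    using z unfolding eig by auto
  show ?thesis unfolding zi by (rule hermitian_conjugation_diag_real[OF B unitaryD(1)[OF P] i])
qed

text \<open>The sum of the absolute values is a trace: multiplying \<open>P\<^sup>* C P\<close> by the diagonal matrix \<open>S\<close> of
  conjugate phases makes its diagonal nonnegative without changing absolute values, and by
  cyclicity the trace of \<open>S P\<^sup>* C P\<close> equals that of \<open>(P S P\<^sup>*) C\<close>, where \<open>P S P\<^sup>*\<close> has norm at most
  \<open>1\<close>. Duality then applies.\<close>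

lemma sum_cmod_diag_le_trace_norm:
  assumes C: "C \<in> carrier_mat n n" and P: "unitary n P"
  shows "(\<Sum>i<n. cmod ((mat_adjoint P * C * P) $$ (i, i))) \<le> trace_norm C"
proof -
  note p = unitaryD[OF P]
  define D where "D = mat_adjoint P * C * P"
  have D: "D \<in> carrier_mat n n" using C p by (simp add: D_def)
  define s where "s i = cnj (sgn (D $$ (i, i)))" for i
  define S where "S = mat n n (\<lambda>(i, j). if i = j then s i else 0)"
  have S: "S \<in> carrier_mat n n" by (simp add: S_def)
  have Sij: "S $$ (i, j) = (if i = j then s i else 0)" if "i < n" "j < n" for i j
    using that by (simp add: S_def)
  have s: "s i * D $$ (i, i) = of_real (cmod (D $$ (i, i)))" for i
    unfolding s_def sgn_eq
    by (cases "D $$ (i, i) = 0")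
      (auto simp: complex_norm_square[symmetric] power2_eq_square mult.commute[of "cnj _"])
  have "op_bound S 1" unfolding op_bound_def
  proof
    fix v :: "complex Matrix.vec" assume "v \<in> carrier_vec (dim_col S)"
    hence v: "v \<in> carrier_vec n" using S by simp
    have Sv: "vec_index (S *\<^sub>v v) i = s i * vec_index v i" if "i < n" for i
    proof -
      have "vec_index (S *\<^sub>v v) i = (\<Sum>j<n. (if i = j then s i else 0) * vec_index v j)"
        using that v by (auto simp: scalar_prod_def atLeast0LessThan S_def)
      also have "\<dots> = (\<Sum>j<n. (if i = j then s i * vec_index v j else 0))"
        by (intro sum.cong) auto
      finally show ?thesis using that by simp
    qed
    have "cmod (s i) \<le> 1" for i by (simp add: s_def norm_sgn)
    hence "euclid_norm (S *\<^sub>v v) \<le> euclid_norm v"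
      unfolding euclid_norm_def using v S Sv
      by (auto intro!: L2_set_mono simp: norm_mult mult_left_le_one_le)
    thus "euclid_norm (S *\<^sub>v v) \<le> 1 * euclid_norm v" by simp
  qed
  hence "op_bound (P * S * mat_adjoint P) (1 * 1 * 1)"
    using p S
    by (intro op_bound_mult[of _ n n _ n] op_bound_unitary[OF P]
        op_bound_unitary[OF unitary_adjoint[OF P]]) auto
  moreover have "P * S * mat_adjoint P \<in> carrier_mat n n" using p S by simp
  ultimately have "cmod (mtrace (P * S * mat_adjoint P * C)) \<le> trace_norm C"
    using cmod_mtrace_mult_le[OF _ C] by (metis mult_1)
  also have "mtrace (P * S * mat_adjoint P * C) = mtrace (P * (S * mat_adjoint P * C))"
    using p S C by (simp add: assoc_mult_mat[of _ n n _ n _ n])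
  also have "\<dots> = mtrace ((S * mat_adjoint P * C) * P)"
    using p S C by (intro mtrace_comm[of _ n n]) auto
  also have "(S * mat_adjoint P * C) * P = S * D"
    using p S C by (simp add: D_def assoc_mult_mat[of _ n n _ n _ n])
  also have "mtrace (S * D) = (\<Sum>i<n. \<Sum>l<n. (if i = l then s i else 0) * D $$ (l, i))"
    unfolding mtrace_def index_mult_mat(2) carrier_matD[OF S]
    by (intro sum.cong refl) (simp add: mat_mult_index_sum[OF S D] Sij del: index_mult_mat(1))
  also have "\<dots> = (\<Sum>i<n. \<Sum>l<n. (if i = l then s i * D $$ (l, i) else 0))"
    by (intro sum.cong) auto
  also have "\<dots> = (\<Sum>i<n. s i * D $$ (i, i))" by simp
  also have "\<dots> = of_real (\<Sum>i<n. cmod (D $$ (i, i)))" by (simp add: s)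
  finally show ?thesis unfolding D_def[symmetric] norm_of_real by linarith
qed

text \<open>In a unitary basis triangularising \<open>B + C\<close>, the contribution of \<open>B\<close> to the diagonal is real, so the
  imaginary parts of the eigenvalues come from the diagonal of the conjugated \<open>C\<close> alone.\<close>

theorem sum_Im_eigenvalues_le:
  assumes B: "B \<in> carrier_mat n n" "hermitian_mat B" and C: "C \<in> carrier_mat n n"
  shows "(\<Sum>z\<in>#eigenvalues (B + C). \<bar>Im z\<bar>) \<le> trace_norm C"
proof -
  have A: "B + C \<in> carrier_mat n n" using B C by simp
  obtain P where P: "unitary n P" and eig: "eigenvalues (B + C) =
      {# (mat_adjoint P * (B + C) * P) $$ (i, i). i \<in># mset_set {..<n} #}"
    by (rule eigenvalues_schur[OF A])
  note p = unitaryD[OF P]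
  have "mat_adjoint P * (B + C) * P = mat_adjoint P * B * P + mat_adjoint P * C * P"
    using p B C by (simp add: mult_add_distrib_mat[of _ n n _ n] add_mult_distrib_mat[of _ n n _ _ n])
  hence split: "(mat_adjoint P * (B + C) * P) $$ (i, i) =
      (mat_adjoint P * B * P) $$ (i, i) + (mat_adjoint P * C * P) $$ (i, i)" if "i < n" for i
    using that p(1) by (simp only: index_add_mat(1) index_mult_mat(2,3) mat_adjoint_dim carrier_matD)
  have "\<bar>Im ((mat_adjoint P * (B + C) * P) $$ (i, i))\<bar> \<le> cmod ((mat_adjoint P * C * P) $$ (i, i))"
    if "i < n" for i
    unfolding split[OF that] plus_complex.sel hermitian_conjugation_diag_real[OF B p(1) that]
    using abs_Im_le_cmod by simp
  hence "(\<Sum>i<n. \<bar>Im ((mat_adjoint P * (B + C) * P) $$ (i, i))\<bar>)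
      \<le> (\<Sum>i<n. cmod ((mat_adjoint P * C * P) $$ (i, i)))"
    by (intro sum_mono) simp
  also have "\<dots> \<le> trace_norm C" by (rule sum_cmod_diag_le_trace_norm[OF C P])
  finally show ?thesis
    by (simp add: eig image_mset.compositionality o_def sum_unfold_sum_mset)
qed

lemma upper_triangular_pow:
  fixes T :: "complex mat"
  assumes T: "T \<in> carrier_mat n n" "upper_triangular T"
  shows "upper_triangular (T ^\<^sub>m k)" and "\<And>i. i < n \<Longrightarrow> (T ^\<^sub>m k) $$ (i, i) = (T $$ (i, i)) ^ k"
proof -
  have Tk: "T ^\<^sub>m k \<in> carrier_mat n n" for k using T by simp
  have "upper_triangular (T ^\<^sub>m k) \<and> (\<forall>i<n. (T ^\<^sub>m k) $$ (i, i) = (T $$ (i, i)) ^ k)"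
  proof (induction k)
    case (Suc k)
    have entry: "(T ^\<^sub>m Suc k) $$ (i, j) = (\<Sum>l<n. (T ^\<^sub>m k) $$ (i, l) * T $$ (l, j))"
      if "i < n" "j < n" for i j
      using mat_mult_index_sum[OF Tk T(1) that] by simp
    have z: "(T ^\<^sub>m k) $$ (i, l) * T $$ (l, j) = 0" if "i < n" "l < n" "l < i \<or> j < l" for i j l
      using that T Suc Tk[of k] by (auto simp: upper_triangular_def)
    have "(T ^\<^sub>m Suc k) $$ (i, j) = 0" if "i < n" "j < i" for i j
      unfolding entry[OF that(1) less_trans[OF that(2,1)]]
      using that z by (intro sum.neutral) (metis lessThan_iff linorder_neqE_nat less_trans)
    moreover have "(T ^\<^sub>m Suc k) $$ (i, i) = (T $$ (i, i)) ^ Suc k" if "i < n" for i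
    proof -
      have "(T ^\<^sub>m k) $$ (i, l) * T $$ (l, i) = 0" if "l < n" "l \<noteq> i" for l
        using z[OF \<open>i < n\<close> that(1), of i] that(2) by (meson linorder_neqE_nat)
      hence "(\<Sum>l<n. (T ^\<^sub>m k) $$ (i, l) * T $$ (l, i))
          = (\<Sum>l<n. if l = i then (T ^\<^sub>m k) $$ (i, i) * T $$ (i, i) else 0)"
        by (intro sum.cong refl) auto
      thus ?thesis unfolding entry[OF that that] using that Suc by simp
    qed
    ultimately show ?case using Tk[of "Suc k"] by (auto simp: upper_triangular_def)
  qed (use T in auto)
  thus "upper_triangular (T ^\<^sub>m k)" "\<And>i. i < n \<Longrightarrow> (T ^\<^sub>m k) $$ (i, i) = (T $$ (i, i)) ^ k"
    by auto
qed

lemma mtrace_pow: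
  assumes A: "A \<in> carrier_mat n n"
  shows "mtrace (A ^\<^sub>m k) = (\<Sum>z\<in>#eigenvalues A. z ^ k)"
proof -
  obtain P where P: "unitary n P" "upper_triangular (mat_adjoint P * A * P)"
    and eig: "eigenvalues A = {# (mat_adjoint P * A * P) $$ (i, i). i \<in># mset_set {..<n} #}"
    by (rule eigenvalues_schur[OF A])
  note p = unitaryD[OF P(1)]
  define T where "T = mat_adjoint P * A * P"
  have T: "T \<in> carrier_mat n n" using A p by (simp add: T_def)
  have Tk: "T ^\<^sub>m k \<in> carrier_mat n n" using T by simp
  have "P * T * mat_adjoint P = (P * mat_adjoint P) * A * (P * mat_adjoint P)"
    unfolding T_def using A p(1,2) by (simp add: assoc_mult_mat[of _ n n _ n _ n])
  hence "A = P * T * mat_adjoint P" using p A by simp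
  hence "similar_mat_wit A T P (mat_adjoint P)"
    by (intro similar_mat_witI[OF p(4,3) _ A T p(1,2)])
  hence "A ^\<^sub>m k = P * T ^\<^sub>m k * mat_adjoint P" by (rule similar_mat_wit_pow_id)
  hence "mtrace (A ^\<^sub>m k) = mtrace (P * T ^\<^sub>m k * mat_adjoint P)" by (simp only:)
  also have "\<dots> = mtrace (mat_adjoint P * (P * T ^\<^sub>m k))"
    by (rule mtrace_comm[of _ n n]) (use p Tk in simp_all)
  also have "mat_adjoint P * (P * T ^\<^sub>m k) = (mat_adjoint P * P) * T ^\<^sub>m k"
    using p(1,2) Tk by (simp add: assoc_mult_mat[of _ n n _ n _ n])
  also have "\<dots> = T ^\<^sub>m k" unfolding p(3) by (rule left_mult_one_mat[OF Tk])
  also have "mtrace (T ^\<^sub>m k) = (\<Sum>i<n. (T $$ (i, i)) ^ k)"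
    unfolding mtrace_def using T upper_triangular_pow[OF T P(2)[folded T_def]] by simp
  finally show ?thesis
    by (simp add: eig T_def image_mset.compositionality o_def sum_unfold_sum_mset)
qed

text \<open>The extra factor \<open>X\<close> makes the telescoping an induction on \<open>k\<close>: with \<open>A = B + C\<close>,
  \<open>A\<^sup>k\<^sup>+\<^sup>1 X - B\<^sup>k\<^sup>+\<^sup>1 X = (A\<^sup>k - B\<^sup>k) (A X) + B\<^sup>k C X\<close>, where the first term is the induction hypothesis for
  \<open>A X\<close> and the trace of the second is bounded by duality. The assumption \<open>L \<ge> 1\<close> allows the simple
  bound with \<open>L\<^sup>k\<close> in place of \<open>L\<^sup>k\<^sup>-\<^sup>1\<close>, which needs no separate case \<open>k = 0\<close>.\<close>

lemma cmod_mtrace_pow_diff_le: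
  assumes B: "B \<in> carrier_mat n n" and C: "C \<in> carrier_mat n n"
    and bA: "op_bound (B + C) L" and bB: "op_bound B L" and L: "L \<ge> 1"
    and X: "X \<in> carrier_mat n n" "op_bound X M" "M \<ge> 0"
  shows "cmod (mtrace ((B + C) ^\<^sub>m k * X) - mtrace (B ^\<^sub>m k * X)) \<le> real k * L ^ k * M * trace_norm C"
  using X
proof (induction k arbitrary: X M)
  case 0
  thus ?case using B C by simp
next
  case (Suc k)
  define A where "A = B + C"
  have A: "A \<in> carrier_mat n n" using B C by (simp add: A_def)
  note X = Suc.prems
  have pw: "A ^\<^sub>m k \<in> carrier_mat n n" "B ^\<^sub>m k \<in> carrier_mat n n" using A B by auto
  have AX: "A * X \<in> carrier_mat n n" "op_bound (A * X) (L * M)"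
    using A X L bA by (auto simp: A_def intro!: op_bound_mult[of _ n n _ n])
  have 1: "A ^\<^sub>m Suc k * X = A ^\<^sub>m k * (A * X)"
    using A X pw by (simp add: assoc_mult_mat[of _ n n _ n _ n])
  have "A * X = B * X + C * X" using B C X by (simp add: A_def add_mult_distrib_mat[of _ n n _ _ n])
  hence "B ^\<^sub>m k * (A * X) = B ^\<^sub>m Suc k * X + B ^\<^sub>m k * (C * X)"
    using B C X pw by (simp add: mult_add_distrib_mat[of _ n n _ n] assoc_mult_mat[of _ n n _ n _ n])
  hence 2: "mtrace (B ^\<^sub>m Suc k * X) = mtrace (B ^\<^sub>m k * (A * X)) - mtrace (B ^\<^sub>m k * (C * X))"
    using B C X pw by (simp add: mtrace_add[of _ n] assoc_mult_mat[of _ n n _ n _ n])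
  have "B ^\<^sub>m k * (C * X) = (B ^\<^sub>m k * C) * X"
    using C X pw by (simp add: assoc_mult_mat[of _ n n _ n _ n])
  hence "mtrace (B ^\<^sub>m k * (C * X)) = mtrace (X * (B ^\<^sub>m k * C))"
    using C X pw mtrace_comm[of "B ^\<^sub>m k * C" n n X] by simp
  also have "X * (B ^\<^sub>m k * C) = X * B ^\<^sub>m k * C"
    using C X pw by (simp add: assoc_mult_mat[of _ n n _ n _ n])
  finally have 3: "mtrace (B ^\<^sub>m k * (C * X)) = mtrace (X * B ^\<^sub>m k * C)" .
  have "op_bound (X * B ^\<^sub>m k) (M * L ^ k)"
    using B X L pw bB by (intro op_bound_mult[of _ n n _ n] op_bound_pow[of _ n]) auto
  hence 4: "cmod (mtrace (X * B ^\<^sub>m k * C)) \<le> M * L ^ k * trace_norm C"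
    using X pw C by (intro cmod_mtrace_mult_le) auto
  have tn: "trace_norm C \<ge> 0"
    using order.trans[OF sum_nonneg sum_cmod_diag_le_trace_norm[OF C, of "1\<^sub>m n"]]
    by (simp add: unitary_def)
  have "cmod (mtrace (A ^\<^sub>m Suc k * X) - mtrace (B ^\<^sub>m Suc k * X))
      = cmod ((mtrace (A ^\<^sub>m k * (A * X)) - mtrace (B ^\<^sub>m k * (A * X))) + mtrace (X * B ^\<^sub>m k * C))"
    unfolding 1 2 3 by (simp add: algebra_simps)
  also have "\<dots> \<le> real k * L ^ k * (L * M) * trace_norm C + M * L ^ k * trace_norm C"
    using Suc.IH[OF AX] L X(3) 4 unfolding A_def[symmetric]
    by (intro order.trans[OF norm_triangle_ineq] add_mono) auto
  also have "M * L ^ k * trace_norm C \<le> M * L ^ Suc k * trace_norm C"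
    using L X(3) tn by (intro mult_right_mono mult_left_mono power_increasing) auto
  also have "real k * L ^ k * (L * M) * trace_norm C + M * L ^ Suc k * trace_norm C
      = real (Suc k) * L ^ Suc k * M * trace_norm C"
    by (simp add: algebra_simps)
  finally show ?case unfolding A_def by simp
qed

theorem power_sum_eigenvalues_diff_le:
  assumes B: "B \<in> carrier_mat n n" and C: "C \<in> carrier_mat n n"
    and bA: "op_bound (B + C) L" and bB: "op_bound B L" and L: "L \<ge> 1"
  shows "cmod ((\<Sum>z\<in>#eigenvalues (B + C). z ^ k) - (\<Sum>z\<in>#eigenvalues B. z ^ k))
    \<le> real k * L ^ k * trace_norm C"
proof -
  have "unitary n (1\<^sub>m n)" by (simp add: unitary_def)
  note op_bound_unitary[OF this]
  from cmod_mtrace_pow_diff_le[OF B C bA bB L _ this, of k]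
  have "cmod (mtrace ((B + C) ^\<^sub>m k) - mtrace (B ^\<^sub>m k)) \<le> real k * L ^ k * trace_norm C"
    using B C by (simp add: right_mult_one_mat[of _ n n])
  thus ?thesis using B C by (simp add: mtrace_pow[of _ n])
qed

section \<open>Convergence of averages from moments\<close>

lemma norm_sum_mset_le:
  fixes f :: "'a \<Rightarrow> 'b::real_normed_vector"
  shows "norm (\<Sum>x\<in>#M. f x) \<le> (\<Sum>x\<in>#M. norm (f x))"
  by (induction M) (auto intro: order.trans[OF norm_triangle_ineq])

lemma sum_mset_diff_distrib:
  fixes f :: "'a \<Rightarrow> 'b::ab_group_add"
  shows "(\<Sum>x\<in>#M. f x - g x) = (\<Sum>x\<in>#M. f x) - (\<Sum>x\<in>#M. g x)"
  by (induction M) (auto simp: algebra_simps)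

lemma of_real_sum_mset:
  "of_real (\<Sum>x\<in>#M. f x) = (\<Sum>x\<in>#M. of_real (f x) :: complex)"
  by (induction M) auto

lemma sum_mset_complex_parts:
  "(\<Sum>x\<in>#M. f x) = Complex (\<Sum>x\<in>#M. Re (f x)) (\<Sum>x\<in>#M. Im (f x))"
  by (induction M) (auto simp: complex_eq_iff)

lemma sum_mset_poly:
  fixes g :: "'a \<Rightarrow> real"
  shows "(\<Sum>x\<in>#M. \<Sum>i\<le>m. a i * g x ^ i) = (\<Sum>i\<le>m. a i * (\<Sum>x\<in>#M. g x ^ i))"
  by (induction M) (auto simp: sum.distrib algebra_simps)

lemma abs_sum_mset_diff_le:
  fixes f g :: "'a \<Rightarrow> real"
  assumes "\<And>x. x \<in># M \<Longrightarrow> \<bar>f x - g x\<bar> \<le> e"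
  shows "\<bar>(\<Sum>x\<in>#M. f x) - (\<Sum>x\<in>#M. g x)\<bar> \<le> real (size M) * e"
proof -
  have "\<bar>(\<Sum>x\<in>#M. f x - g x)\<bar> \<le> (\<Sum>x\<in>#M. \<bar>f x - g x\<bar>)"
    using norm_sum_mset_le[of "\<lambda>x. f x - g x" M] by simp
  also have "\<dots> \<le> (\<Sum>x\<in>#M. e)" by (intro sum_mset_mono assms)
  finally show ?thesis by (simp add: sum_mset_diff_distrib)
qed

lemma cmod_power_diff_le:
  assumes "cmod z \<le> L" "cmod w \<le> L" "L \<ge> 1"
  shows "cmod (z ^ k - w ^ k) \<le> real k * L ^ k * cmod (z - w)"
proof (induction k)
  case (Suc k)
  have "z ^ Suc k - w ^ Suc k = z * (z ^ k - w ^ k) + (z - w) * w ^ k" by (simp add: algebra_simps)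
  also have "cmod \<dots> \<le> cmod z * cmod (z ^ k - w ^ k) + cmod (z - w) * cmod w ^ k"
    by (rule order.trans[OF norm_triangle_ineq]) (simp add: norm_mult norm_power)
  also have "\<dots> \<le> L * (real k * L ^ k * cmod (z - w)) + cmod (z - w) * L ^ Suc k"
  proof (intro add_mono mult_mono Suc)
    have "cmod w ^ k \<le> L ^ k" using assms by (intro power_mono) auto
    also have "\<dots> \<le> L ^ Suc k" using assms by (intro power_increasing) auto
    finally show "cmod w ^ k \<le> L ^ Suc k" .
  qed (use assms in auto)
  also have "\<dots> = real (Suc k) * L ^ Suc k * cmod (z - w)" by (simp add: algebra_simps)
  finally show ?case .
qed auto

text \<open>The facts about the two spectra that survive from linear algebra: \<open>M n\<close> is the perturbed
  spectrum, \<open>N n\<close> the real one, \<open>L\<close> the radius of a disc containing both, and \<open>t n\<close> the size of the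
  perturbation.\<close>

definition asymptotically_close ::
  "(nat \<Rightarrow> complex multiset) \<Rightarrow> (nat \<Rightarrow> complex multiset) \<Rightarrow> real \<Rightarrow> (nat \<Rightarrow> real) \<Rightarrow> bool" where
  "asymptotically_close M N L t \<longleftrightarrow> L \<ge> 1 \<and> (\<lambda>n. t n / real n) \<longlonglongrightarrow> 0 \<and>
    (\<forall>\<^sub>F n in sequentially. size (M n) = n \<and> size (N n) = n \<and>
      (\<forall>z\<in>#M n. cmod z \<le> L) \<and> (\<forall>z\<in>#N n. cmod z \<le> L \<and> Im z = 0) \<and>
      (\<Sum>z\<in>#M n. \<bar>Im z\<bar>) \<le> t n \<and>
      (\<forall>k. cmod ((\<Sum>z\<in>#M n. z ^ k) - (\<Sum>z\<in>#N n. z ^ k)) \<le> real k * L ^ k * t n))"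

text \<open>The factor \<open>2\<close> has two sources of equal size: replacing the points of \<open>M\<close> by their real parts, and
  the difference of the complex power sums.\<close>

lemma power_sum_Re_diff_le:
  assumes L: "L \<ge> 1" and M: "\<forall>z\<in>#M. cmod z \<le> L" and N: "\<forall>z\<in>#N. Im z = 0"
    and t: "(\<Sum>z\<in>#M. \<bar>Im z\<bar>) \<le> t"
    and d: "cmod ((\<Sum>z\<in>#M. z ^ k) - (\<Sum>z\<in>#N. z ^ k)) \<le> real k * L ^ k * t"
  shows "\<bar>(\<Sum>z\<in>#M. Re z ^ k) - (\<Sum>z\<in>#N. Re z ^ k)\<bar> \<le> 2 * real k * L ^ k * t"
proof -
  have "cmod ((\<Sum>z\<in>#M. z ^ k) - (\<Sum>z\<in>#M. of_real (Re z) ^ k))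
      \<le> (\<Sum>z\<in>#M. cmod (z ^ k - of_real (Re z) ^ k))"
    unfolding sum_mset_diff_distrib[symmetric] by (rule norm_sum_mset_le)
  also have "\<dots> \<le> (\<Sum>z\<in>#M. real k * L ^ k * \<bar>Im z\<bar>)"
  proof (rule sum_mset_mono)
    fix z assume z: "z \<in># M"
    have "cmod (z ^ k - of_real (Re z) ^ k) \<le> real k * L ^ k * cmod (z - of_real (Re z))"
      using z M L abs_Re_le_cmod[of z] by (intro cmod_power_diff_le) (auto intro: order.trans)
    also have "cmod (z - of_real (Re z)) = \<bar>Im z\<bar>" by (simp add: cmod_def)
    finally show "cmod (z ^ k - of_real (Re z) ^ k) \<le> real k * L ^ k * \<bar>Im z\<bar>" .
  qed
  also have "\<dots> \<le> real k * L ^ k * t"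
    unfolding sum_mset_distrib_left[symmetric] using L t by (intro mult_left_mono) auto
  finally have 1: "cmod ((\<Sum>z\<in>#M. z ^ k) - (\<Sum>z\<in>#M. of_real (Re z) ^ k)) \<le> real k * L ^ k * t" .
  have "z = of_real (Re z)" if "z \<in># N" for z using N that by (simp add: complex_eq_iff)
  hence 2: "(\<Sum>z\<in>#N. z ^ k) = (\<Sum>z\<in>#N. of_real (Re z) ^ k)"
    by (intro arg_cong[of _ _ sum_mset] image_mset_cong) metis
  have "\<bar>(\<Sum>z\<in>#M. Re z ^ k) - (\<Sum>z\<in>#N. Re z ^ k)\<bar>
      = cmod ((\<Sum>z\<in>#M. of_real (Re z) ^ k) - (\<Sum>z\<in>#N. of_real (Re z) ^ k))"
    by (simp only: of_real_power[symmetric] of_real_sum_mset[symmetric] of_real_diff[symmetric] norm_of_real)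
  also have "\<dots> \<le> cmod ((\<Sum>z\<in>#M. z ^ k) - (\<Sum>z\<in>#N. z ^ k)) +
      cmod ((\<Sum>z\<in>#M. z ^ k) - (\<Sum>z\<in>#M. of_real (Re z) ^ k))"
    using norm_triangle_ineq4[of "(\<Sum>z\<in>#M. z ^ k) - (\<Sum>z\<in>#N. z ^ k)"
        "(\<Sum>z\<in>#M. z ^ k) - (\<Sum>z\<in>#M. of_real (Re z) ^ k)"] unfolding 2 by simp
  also have "\<dots> \<le> real k * L ^ k * t + real k * L ^ k * t" by (intro add_mono d 1)
  also have "\<dots> = 2 * real k * L ^ k * t" by (simp add: algebra_simps)
  finally show ?thesis .
qed

text \<open>Approximate \<open>f\<close> uniformly on \<open>[-L, L]\<close> by a polynomial. The error of approximation contributes a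
  small multiple of \<open>n\<close> for each multiset, and the sums of the polynomial over the two multisets
  differ by a constant, depending on the polynomial only, times \<open>t n = o(n)\<close>.\<close>

lemma asymptotically_close_Re:
  fixes f :: "real \<Rightarrow> real"
  assumes close: "asymptotically_close M N L t" and f: "continuous_on {-L..L} f"
  shows "(\<lambda>n. ((\<Sum>z\<in>#M n. f (Re z)) - (\<Sum>z\<in>#N n. f (Re z))) / real n) \<longlonglongrightarrow> 0"
proof (rule tendstoI)
  fix e :: real assume e: "e > 0"
  have L: "L \<ge> 1" and t: "(\<lambda>n. t n / real n) \<longlonglongrightarrow> 0"
    using close by (auto simp: asymptotically_close_def)
  obtain g where g: "real_polynomial_function g" "\<And>x. x \<in> {-L..L} \<Longrightarrow> \<bar>f x - g x\<bar> < e / 4"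
    by (rule Stone_Weierstrass_real_polynomial_function[OF compact_Icc f, of "e / 4"]) (use e in auto)
  obtain a m where gsum: "g = (\<lambda>x. \<Sum>i\<le>m. a i * x ^ i)"
    using real_polynomial_function_imp_sum[OF g(1)] by blast
  define D where "D = (\<Sum>i\<le>m. \<bar>a i\<bar> * (2 * real i * L ^ i))"
  have "(\<lambda>n. D * (t n / real n)) \<longlonglongrightarrow> D * 0" by (intro tendsto_intros t)
  hence "\<forall>\<^sub>F n in sequentially. D * (t n / real n) < e / 2"
    using e by (intro order_tendstoD) auto
  moreover have "\<forall>\<^sub>F n in sequentially. \<bar>(\<Sum>z\<in>#M n. f (Re z)) - (\<Sum>z\<in>#N n. f (Re z))\<bar>
      \<le> real n * (e / 2) + D * t n"
    using close[unfolded asymptotically_close_def, THEN conjunct2, THEN conjunct2]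
  proof eventually_elim
    case (elim n)
    let ?M = "M n" and ?N = "N n"
    have ReL: "Re z \<in> {-L..L}" if "cmod z \<le> L" for z
      using that abs_Re_le_cmod[of z] by auto
    have 1: "\<bar>(\<Sum>z\<in>#?M. f (Re z)) - (\<Sum>z\<in>#?M. g (Re z))\<bar> \<le> real (size ?M) * (e / 4)"
      using elim ReL g(2) by (intro abs_sum_mset_diff_le less_imp_le) auto
    have 2: "\<bar>(\<Sum>z\<in>#?N. f (Re z)) - (\<Sum>z\<in>#?N. g (Re z))\<bar> \<le> real (size ?N) * (e / 4)"
      using elim ReL g(2) by (intro abs_sum_mset_diff_le less_imp_le) auto
    have "(\<Sum>z\<in>#?M. g (Re z)) - (\<Sum>z\<in>#?N. g (Re z))
        = (\<Sum>i\<le>m. a i * ((\<Sum>z\<in>#?M. Re z ^ i) - (\<Sum>z\<in>#?N. Re z ^ i)))"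
      unfolding gsum sum_mset_poly by (simp add: sum_subtractf right_diff_distrib)
    also have "\<bar>\<dots>\<bar> \<le> (\<Sum>i\<le>m. \<bar>a i\<bar> * (2 * real i * L ^ i * t n))"
      using elim L
      by (intro order.trans[OF sum_abs] sum_mono)
        (auto simp: abs_mult intro!: mult_left_mono power_sum_Re_diff_le)
    also have "\<dots> = D * t n" by (simp add: D_def sum_distrib_right mult.assoc)
    finally have 3: "\<bar>(\<Sum>z\<in>#?M. g (Re z)) - (\<Sum>z\<in>#?N. g (Re z))\<bar> \<le> D * t n" .
    have "size ?M = n" "size ?N = n" using elim by auto
    note 1 = 1[unfolded this] and 2 = 2[unfolded this]
    have "\<bar>a - b\<bar> \<le> x + x + y" if "\<bar>a - a'\<bar> \<le> x" "\<bar>b - b'\<bar> \<le> x" "\<bar>a' - b'\<bar> \<le> y"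
      for a b a' b' x y :: real using that by linarith
    from this[OF 1 2 3] show ?case by (simp add: mult.commute)
  qed
  moreover have "\<forall>\<^sub>F n in sequentially. n > 0" by (rule eventually_gt_at_top)
  ultimately show "\<forall>\<^sub>F n in sequentially.
      dist (((\<Sum>z\<in>#M n. f (Re z)) - (\<Sum>z\<in>#N n. f (Re z))) / real n) 0 < e"
  proof eventually_elim
    case (elim n)
    have "\<bar>(\<Sum>z\<in>#M n. f (Re z)) - (\<Sum>z\<in>#N n. f (Re z))\<bar> / real n \<le> (real n * (e / 2) + D * t n) / real n"
      using elim by (intro divide_right_mono) auto
    also have "\<dots> = e / 2 + D * (t n / real n)" using elim by (simp add: field_simps)
    also have "\<dots> < e" using elim(1) by linarith
    finally show ?case by simp
  qed
qed

text \<open>On the disc \<open>F\<close> is uniformly continuous and bounded, which gives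
  \<open>\<bar>F z - F (Re z)\<bar> \<le> e / 2 + const * \<bar>Im z\<bar>\<close>: points near the real axis are covered by the
  first term and the others by the second. Summed over \<open>M n\<close> the second term is \<open>O(t n) = o(n)\<close>.\<close>

lemma asymptotically_close_project:
  fixes F :: "complex \<Rightarrow> complex"
  assumes close: "asymptotically_close M N L t" and F: "continuous_on UNIV F"
  shows "(\<lambda>n. ((\<Sum>z\<in>#M n. F z) - (\<Sum>z\<in>#M n. F (of_real (Re z)))) / of_nat n) \<longlonglongrightarrow> 0"
proof (rule tendstoI)
  fix e :: real assume e: "e > 0"
  have L: "L \<ge> 1" and t: "(\<lambda>n. t n / real n) \<longlonglongrightarrow> 0"
    using close by (auto simp: asymptotically_close_def)
  have cont: "continuous_on (cball 0 L) F" using F continuous_on_subset by blast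
  obtain d where d: "d > 0"
    "\<And>x y. x \<in> cball 0 L \<Longrightarrow> y \<in> cball 0 L \<Longrightarrow> dist y x < d \<Longrightarrow> dist (F y) (F x) < e / 2"
    using compact_uniformly_continuous[OF cont compact_cball] e
    unfolding uniformly_continuous_on_def by (metis half_gt_zero)
  have "bounded (F ` cball 0 L)" by (intro compact_imp_bounded compact_continuous_image cont compact_cball)
  then obtain b where b: "b > 0" "\<And>x. x \<in> cball 0 L \<Longrightarrow> cmod (F x) \<le> b"
    unfolding bounded_pos by auto
  have pt: "cmod (F z - F (of_real (Re z))) \<le> e / 2 + 2 * b / d * \<bar>Im z\<bar>" if z: "cmod z \<le> L" for z
  proof -
    have c: "z \<in> cball 0 L" "complex_of_real (Re z) \<in> cball 0 L"
      using z abs_Re_le_cmod[of z] by (auto simp: dist_norm)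
    have dz: "dist z (of_real (Re z)) = \<bar>Im z\<bar>" by (simp add: dist_norm cmod_def)
    show ?thesis
    proof (cases "\<bar>Im z\<bar> < d")
      case True
      have "cmod (F z - F (of_real (Re z))) < e / 2"
        using d(2)[OF c(2,1)] True dz by (simp add: dist_norm)
      moreover have "2 * b / d * \<bar>Im z\<bar> \<ge> 0" using b d by auto
      ultimately show ?thesis by linarith
    next
      case False
      have "cmod (F z - F (of_real (Re z))) \<le> b + b"
        using b(2)[OF c(1)] b(2)[OF c(2)] by (intro order.trans[OF norm_triangle_ineq4]) auto
      also have "\<dots> = 2 * b / d * d" using d by simp
      also have "\<dots> \<le> 2 * b / d * \<bar>Im z\<bar>" using False b d by (intro mult_left_mono) auto
      finally show ?thesis using e by simp
    qed
  qed
  have "(\<lambda>n. 2 * b / d * (t n / real n)) \<longlonglongrightarrow> 2 * b / d * 0" by (intro tendsto_intros t)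
  hence "\<forall>\<^sub>F n in sequentially. 2 * b / d * (t n / real n) < e / 2"
    using e by (intro order_tendstoD) auto
  moreover have "\<forall>\<^sub>F n in sequentially. n > 0" by (rule eventually_gt_at_top)
  ultimately show "\<forall>\<^sub>F n in sequentially.
      dist (((\<Sum>z\<in>#M n. F z) - (\<Sum>z\<in>#M n. F (of_real (Re z)))) / of_nat n) 0 < e"
    using close[unfolded asymptotically_close_def, THEN conjunct2, THEN conjunct2]
  proof eventually_elim
    case (elim n)
    have "cmod ((\<Sum>z\<in>#M n. F z) - (\<Sum>z\<in>#M n. F (of_real (Re z))))
        \<le> (\<Sum>z\<in>#M n. cmod (F z - F (of_real (Re z))))"
      unfolding sum_mset_diff_distrib[symmetric] by (rule norm_sum_mset_le)
    also have "\<dots> \<le> (\<Sum>z\<in>#M n. e / 2 + 2 * b / d * \<bar>Im z\<bar>)"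
      using elim by (intro sum_mset_mono pt) auto
    also have "\<dots> = real n * (e / 2) + 2 * b / d * (\<Sum>z\<in>#M n. \<bar>Im z\<bar>)"
      unfolding sum_mset.distrib sum_mset_distrib_left[symmetric] using elim by simp
    also have "\<dots> \<le> real n * (e / 2) + 2 * b / d * t n"
      using elim b d by (intro add_left_mono mult_left_mono) auto
    finally have "cmod ((\<Sum>z\<in>#M n. F z) - (\<Sum>z\<in>#M n. F (of_real (Re z)))) / real n
        \<le> (real n * (e / 2) + 2 * b / d * t n) / real n"
      using elim by (intro divide_right_mono) auto
    also have "\<dots> = e / 2 + 2 * b / d * (t n / real n)" using elim by (simp add: add_divide_distrib)
    also have "\<dots> < e" using elim by simp
    finally show ?case by (simp add: norm_divide)
  qed
qed

theorem asymptotically_close_imp_same_averages: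
  fixes F :: "complex \<Rightarrow> complex"
  assumes close: "asymptotically_close M N L t" and F: "continuous_on UNIV F"
  shows "(\<lambda>n. ((\<Sum>z\<in>#M n. F z) - (\<Sum>z\<in>#N n. F z)) / of_nat n) \<longlonglongrightarrow> 0"
proof -
  have cont: "continuous_on {-L..L} (\<lambda>x. F (of_real x))"
    by (rule continuous_on_compose2[OF F]) (auto intro!: continuous_intros)
  note re = asymptotically_close_Re[OF close, of "\<lambda>x. Re (F (of_real x))", OF continuous_on_Re[OF cont]]
  note im = asymptotically_close_Re[OF close, of "\<lambda>x. Im (F (of_real x))", OF continuous_on_Im[OF cont]]
  have "(\<lambda>n. ((\<Sum>z\<in>#M n. F (of_real (Re z))) - (\<Sum>z\<in>#N n. F (of_real (Re z)))) / of_nat n)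
      \<longlonglongrightarrow> 0"
  proof -
    have eq: "((\<Sum>z\<in>#M n. F (of_real (Re z))) - (\<Sum>z\<in>#N n. F (of_real (Re z)))) / of_nat n
        = Complex (((\<Sum>z\<in>#M n. Re (F (of_real (Re z)))) - (\<Sum>z\<in>#N n. Re (F (of_real (Re z))))) / real n)
          (((\<Sum>z\<in>#M n. Im (F (of_real (Re z)))) - (\<Sum>z\<in>#N n. Im (F (of_real (Re z))))) / real n)" for n
      unfolding sum_mset_complex_parts[of "\<lambda>z. F (of_real (Re z))"]
      by (simp only: complex_eq_iff Re_divide_of_nat Im_divide_of_nat minus_complex.sel complex.sel)
    have "Complex 0 0 = 0" by (simp add: complex_eq_iff)
    thus ?thesis unfolding eq using tendsto_Complex[OF re im] by metis
  qed
  from tendsto_add[OF asymptotically_close_project[OF close F] this]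
  have lim: "(\<lambda>n. ((\<Sum>z\<in>#M n. F z) - (\<Sum>z\<in>#N n. F (of_real (Re z)))) / of_nat n) \<longlonglongrightarrow> 0"
    by (simp add: diff_divide_distrib)
  have ev: "\<forall>\<^sub>F n in sequentially. (\<Sum>z\<in>#N n. F (of_real (Re z))) = (\<Sum>z\<in>#N n. F z)"
    using close[unfolded asymptotically_close_def, THEN conjunct2, THEN conjunct2]
  proof eventually_elim
    case (elim n)
    hence "of_real (Re z) = z" if "z \<in># N n" for z using that by (simp add: complex_eq_iff)
    thus ?case by (intro arg_cong[of _ _ sum_mset] image_mset_cong) simp
  qed
  show ?thesis
    by (rule Lim_transform_eventually[OF lim]) (use ev in \<open>auto elim: eventually_mono\<close>)
qed

section \<open>Consequences of an eigenvalue distribution\<close>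

lemma eigenvalue_distribution_real:
  fixes g :: "complex \<Rightarrow> real" and \<theta> :: "'a::euclidean_space \<Rightarrow> complex"
  assumes A: "eigenvalue_distribution A \<theta> G"
    and g: "continuous_on UNIV g" "bounded {z. g z \<noteq> 0}"
  shows "(\<lambda>n. (\<Sum>z\<in>#eigenvalues (A n). g z) / real n)
    \<longlonglongrightarrow> (LINT t|lebesgue_on G. g (\<theta> t)) / measure lebesgue G"
proof -
  have "continuous_on UNIV (\<lambda>z. complex_of_real (g z))" by (intro continuous_intros g)
  moreover have "bounded {z. complex_of_real (g z) \<noteq> 0}" using g by simp
  ultimately have "(\<lambda>n. (\<Sum>z\<in>#eigenvalues (A n). complex_of_real (g z)) / of_nat n)
      \<longlonglongrightarrow> (LINT t|lebesgue_on G. complex_of_real (g (\<theta> t))) / of_real (measure lebesgue G)"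
    using A unfolding eigenvalue_distribution_def by blast
  also have "(\<lambda>n. (\<Sum>z\<in>#eigenvalues (A n). complex_of_real (g z)) / of_nat n)
      = (\<lambda>n. complex_of_real ((\<Sum>z\<in>#eigenvalues (A n). g z) / real n))"
    unfolding of_real_sum_mset[symmetric] by simp
  also have "(LINT t|lebesgue_on G. complex_of_real (g (\<theta> t))) / of_real (measure lebesgue G)
      = complex_of_real ((LINT t|lebesgue_on G. g (\<theta> t)) / measure lebesgue G)"
    by simp
  finally show ?thesis unfolding tendsto_of_real_iff .
qed

text \<open>If the \<open>j\<close>-th entry of the increasing list, counted from \<open>0\<close>, were at least \<open>e\<close>, only the \<open>j\<close> entries
  before it could be smaller than \<open>e\<close>.\<close>

lemma nth_sorted_less_if_many:
  fixes M :: "real multiset"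
  assumes "size {#x \<in># M. x < e#} > j"
  shows "sorted_list_of_multiset M ! j < e \<and> j < size M"
proof -
  define xs where "xs = sorted_list_of_multiset M"
  have xs: "mset xs = M" "sorted xs" by (simp_all add: xs_def)
  have "size {#x \<in># M. x < e#} = length (filter (\<lambda>x. x < e) xs)"
    unfolding xs(1)[symmetric] by (simp flip: mset_filter)
  hence len: "card {i. i < length xs \<and> xs ! i < e} > j"
    using assms by (simp add: length_filter_conv_card)
  have "xs ! j < e"
  proof (rule ccontr)
    assume ge: "\<not> xs ! j < e"
    have "{i. i < length xs \<and> xs ! i < e} \<subseteq> {..<j}"
    proof safe
      fix i assume i: "i < length xs" "xs ! i < e"
      show "i < j"
      proof (rule ccontr)
        assume "\<not> i < j"
        hence "xs ! j \<le> xs ! i" using i xs(2) by (intro sorted_nth_mono) auto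
        thus False using i ge by simp
      qed
    qed
    from card_mono[OF _ this] show False using len by simp
  qed
  moreover have "j < length xs"
    using len card_mono[of "{..<length xs}" "{i. i < length xs \<and> xs ! i < e}"] by force
  moreover have "length xs = size M" using xs(1) by (metis size_mset)
  ultimately show ?thesis by (simp add: xs_def)
qed

context
  fixes G :: "'a::euclidean_space set" and \<theta> :: "'a \<Rightarrow> complex"
  assumes G: "G \<in> sets lebesgue" "0 < emeasure lebesgue G" "emeasure lebesgue G < \<infinity>"
    and \<theta>: "\<theta> \<in> borel_measurable (lebesgue_on G)"
begin

lemma measure_pos: "measure lebesgue G > 0"
  using G by (simp add: measure_def enn2real_positive_iff)

lemma integrable_test_function:
  fixes g :: "complex \<Rightarrow> real"
  assumes g: "continuous_on UNIV g" "bounded {z. g z \<noteq> 0}"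
  shows "integrable (lebesgue_on G) (\<lambda>t. g (\<theta> t))"
proof -
  interpret finite_measure "lebesgue_on G"
    using G by (intro finite_measureI) (auto simp: emeasure_restrict_space space_restrict_space)
  obtain r where r: "\<And>z. g z \<noteq> 0 \<Longrightarrow> cmod z \<le> r"
    using g(2) by (auto simp: bounded_iff)
  have "bounded (g ` cball 0 r)"
    by (intro compact_imp_bounded compact_continuous_image continuous_on_subset[OF g(1)]) auto
  then obtain b where b: "b > 0" "\<And>z. cmod z \<le> r \<Longrightarrow> \<bar>g z\<bar> \<le> b"
    by (auto simp: bounded_pos)
  have "\<bar>g z\<bar> \<le> b" for z using b r[of z] by (cases "g z = 0") auto
  moreover have "g \<in> borel_measurable borel" using g(1) by (rule borel_measurable_continuous_onI)
  hence "(\<lambda>t. g (\<theta> t)) \<in> borel_measurable (lebesgue_on G)" using \<theta> by measurable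
  ultimately show ?thesis by (intro integrable_const_bound[of _ b]) auto
qed

lemma integral_test_function_eq_0_iff:
  fixes g :: "complex \<Rightarrow> real"
  assumes g: "continuous_on UNIV g" "bounded {z. g z \<noteq> 0}" "\<And>z. g z \<ge> 0"
  shows "(LINT t|lebesgue_on G. g (\<theta> t)) = 0 \<longleftrightarrow> (AE t in lebesgue_on G. g (\<theta> t) = 0)"
  using g by (intro integral_nonneg_eq_0_iff_AE integrable_test_function) auto

lemma sets_ball_vimage: "{t \<in> G. cmod (\<theta> t - s) < e} \<in> sets lebesgue"
proof -
  have "{t \<in> space (lebesgue_on G). cmod (\<theta> t - s) < e} \<in> sets (lebesgue_on G)"
    using \<theta> by measurable
  hence "{t \<in> G. cmod (\<theta> t - s) < e} \<in> sets (lebesgue_on G)" by simp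
  thus ?thesis using G(1) by (simp add: sets_restrict_space_iff)
qed

lemma AE_lebesgue_on_iff: "(AE t in lebesgue_on G. P t) \<longleftrightarrow> (AE t in lebesgue. t \<in> G \<longrightarrow> P t)"
  using G(1) by (intro AE_restrict_space_iff) auto

text \<open>Every value outside the essential range has a ball with null preimage, and by the Lindelof
  property countably many of these balls cover the complement.\<close>

lemma AE_in_essential_range: "AE t in lebesgue_on G. \<theta> t \<in> essential_range \<theta> G"
proof -
  have "\<exists>e>0. emeasure lebesgue {t \<in> G. cmod (\<theta> t - s) < e} = 0" if "s \<notin> essential_range \<theta> G" for s
    using that by (auto simp: essential_range_def)
  then obtain e where e: "\<And>s. s \<notin> essential_range \<theta> G \<Longrightarrow> e s > 0"
    "\<And>s. s \<notin> essential_range \<theta> G \<Longrightarrow> emeasure lebesgue {t \<in> G. cmod (\<theta> t - s) < e s} = 0"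
    by metis
  define B where "B = (\<lambda>s. ball s (e s)) ` (- essential_range \<theta> G)"
  obtain B' where B': "B' \<subseteq> B" "countable B'" "\<Union>B' = \<Union>B"
    by (rule Lindelof[of B]) (auto simp: B_def)
  have "{t \<in> G. \<theta> t \<in> b} \<in> null_sets lebesgue" if b: "b \<in> B'" for b
  proof -
    obtain s where s: "s \<notin> essential_range \<theta> G" "b = ball s (e s)" using b B' by (auto simp: B_def)
    have "{t \<in> G. \<theta> t \<in> b} = {t \<in> G. cmod (\<theta> t - s) < e s}"
      by (auto simp: s(2) dist_norm norm_minus_commute)
    thus ?thesis using e(2)[OF s(1)] sets_ball_vimage by (simp add: null_sets_def)
  qed
  hence null: "(\<Union>b\<in>B'. {t \<in> G. \<theta> t \<in> b}) \<in> null_sets lebesgue"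
    by (intro null_sets_UN' B') auto
  have "AE t in lebesgue. t \<in> G \<longrightarrow> \<theta> t \<in> essential_range \<theta> G"
  proof (rule AE_I'[OF null], rule subsetI)
    fix t assume "t \<in> {t \<in> space lebesgue. \<not> (t \<in> G \<longrightarrow> \<theta> t \<in> essential_range \<theta> G)}"
    hence t: "t \<in> G" "\<theta> t \<notin> essential_range \<theta> G" by auto
    have "\<theta> t \<in> ball (\<theta> t) (e (\<theta> t))" using e(1)[OF t(2)] by simp
    hence "\<theta> t \<in> \<Union>B" using t(2) unfolding B_def by blast
    hence "\<theta> t \<in> \<Union>B'" using B' by simp
    thus "t \<in> (\<Union>b\<in>B'. {t \<in> G. \<theta> t \<in> b})" using t by auto
  qed
  thus ?thesis by (simp add: AE_lebesgue_on_iff)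
qed

lemma essential_range_nonempty: "essential_range \<theta> G \<noteq> {}"
proof
  assume "essential_range \<theta> G = {}"
  hence "AE t in lebesgue. t \<notin> G" using AE_in_essential_range by (simp add: AE_lebesgue_on_iff)
  hence "G \<in> null_sets lebesgue" using G by (simp add: AE_iff_null_sets)
  thus False using G by auto
qed

lemma closed_essential_range: "closed (essential_range \<theta> G)"
proof -
  have "s \<in> essential_range \<theta> G" if s: "s \<in> closure (essential_range \<theta> G)" for s
    unfolding essential_range_def
  proof safe
    fix e :: real assume e: "e > 0"
    then obtain s' where s': "s' \<in> essential_range \<theta> G" "dist s' s < e / 2"
      using s by (metis closure_approachable half_gt_zero)
    have "0 < emeasure lebesgue {t \<in> G. cmod (\<theta> t - s') < e / 2}"
      using s'(1) half_gt_zero[OF e] unfolding essential_range_def by blast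
    also have "\<dots> \<le> emeasure lebesgue {t \<in> G. cmod (\<theta> t - s) < e}"
    proof (intro emeasure_mono sets_ball_vimage, safe)
      fix t assume "cmod (\<theta> t - s') < e / 2"
      thus "cmod (\<theta> t - s) < e"
        using s'(2) norm_triangle_ineq[of "\<theta> t - s'" "s' - s"] by (simp add: dist_norm)
    qed
    finally show "0 < emeasure lebesgue {t \<in> G. cmod (\<theta> t - s) < e}" .
  qed
  thus ?thesis using closure_subset_eq by blast
qed

text \<open>Test functions must have bounded support, so \<open>\<bar>Im z\<bar>\<close> is cut off outside discs of radius \<open>R\<close>; all
  natural \<open>R\<close> together cover the plane. The averages are eventually \<open>0\<close>, hence so are the integrals.\<close>

lemma distribution_real_imp_AE_real:
  assumes A: "eigenvalue_distribution A \<theta> G"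
    and real: "\<forall>\<^sub>F n in sequentially. \<forall>z\<in>#eigenvalues (A n). Im z = 0"
  shows "AE t in lebesgue_on G. \<theta> t \<in> \<real>"
proof -
  define g :: "nat \<Rightarrow> complex \<Rightarrow> real" where "g R z = \<bar>Im z\<bar> * max 0 (real R - cmod z)" for R z
  have "AE t in lebesgue_on G. g R (\<theta> t) = 0" for R
  proof -
    have c: "continuous_on UNIV (g R)" unfolding g_def by (intro continuous_intros)
    have b: "bounded {z. g R z \<noteq> 0}"
      by (rule bounded_subset[OF bounded_cball[of 0 "real R"]]) (auto simp: g_def dist_norm)
    have "\<forall>\<^sub>F n in sequentially. (\<Sum>z\<in>#eigenvalues (A n). g R z) / real n = 0"
      using real
    proof eventually_elim
      case (elim n)
      hence "(\<Sum>z\<in>#eigenvalues (A n). g R z) = (\<Sum>z\<in>#eigenvalues (A n). 0)"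
        by (intro arg_cong[of _ _ sum_mset] image_mset_cong) (simp add: g_def)
      thus ?case by simp
    qed
    hence "(\<lambda>n. (\<Sum>z\<in>#eigenvalues (A n). g R z) / real n) \<longlonglongrightarrow> 0"
      by (rule tendsto_eventually)
    from LIMSEQ_unique[OF this eigenvalue_distribution_real[OF A c b]]
    have "(LINT t|lebesgue_on G. g R (\<theta> t)) = 0" using measure_pos by simp
    thus ?thesis using c b by (subst (asm) integral_test_function_eq_0_iff) (auto simp: g_def)
  qed
  hence "AE t in lebesgue_on G. \<forall>R. g R (\<theta> t) = 0" by (simp add: AE_all_countable)
  thus ?thesis
  proof eventually_elim
    case (elim t)
    obtain R where "cmod (\<theta> t) < real R" using reals_Archimedean2 by blast
    hence "Im (\<theta> t) = 0" using elim[rule_format, of R] by (simp add: g_def max_def split: if_splits)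
    thus ?case by (simp add: complex_is_Real_iff)
  qed
qed

text \<open>The test function \<open>g\<close> vanishes on the essential range, so its averages tend to \<open>0\<close>, and it equals \<open>1\<close>
  at every point of the disc of radius \<open>L\<close> that is outside the neighbourhood. So the number of
  outliers is at most the sum of \<open>g\<close>. The uniform bound on the spectra is what permits cutting \<open>g\<close> off
  to bounded support.\<close>

lemma distribution_imp_weakly_clustered:
  assumes A: "eigenvalue_distribution A \<theta> G"
    and bnd: "\<And>n z. z \<in># eigenvalues (A n) \<Longrightarrow> cmod z \<le> L"
  shows "weakly_clustered A (essential_range \<theta> G)"
  unfolding weakly_clustered_def
proof (intro conjI essential_range_nonempty closed_essential_range allI impI)
  define S where "S = essential_range \<theta> G"
  have S: "S \<noteq> {}" "closed S"
    by (simp_all add: S_def essential_range_nonempty closed_essential_range)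
  fix e :: real assume e: "e > 0"
  define g where "g z = min 1 (infdist z S / e) * max 0 (min 1 (L + 1 - cmod z))" for z
  have c: "continuous_on UNIV g" unfolding g_def using e by (intro continuous_intros) auto
  have b: "bounded {z. g z \<noteq> 0}"
    by (rule bounded_subset[OF bounded_cball[of 0 "L + 1"]]) (auto simp: g_def dist_norm)
  have g0: "g z \<ge> 0" for z using e infdist_nonneg[of z S] by (simp add: g_def)
  have "AE t in lebesgue_on G. g (\<theta> t) = 0"
    using AE_in_essential_range by eventually_elim (simp add: g_def S_def)
  hence "(LINT t|lebesgue_on G. g (\<theta> t)) = 0"
    using integral_test_function_eq_0_iff[OF c b g0] by simp
  hence lim: "(\<lambda>n. (\<Sum>z\<in>#eigenvalues (A n). g z) / real n) \<longlonglongrightarrow> 0"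
    using eigenvalue_distribution_real[OF A c b] by simp
  have g1: "g z = 1" if "z \<notin> nbhd S e" "cmod z \<le> L" for z
  proof -
    obtain x where "x \<in> S" "infdist z S = dist z x" using infdist_attains_inf[OF S(2,1)] by blast
    hence "infdist z S \<ge> e" using that(1) by (auto simp: nbhd_def dist_norm)
    thus ?thesis using e that(2) by (simp add: g_def)
  qed
  have count: "real (size {#z \<in># eigenvalues (A n). z \<notin> nbhd S e#}) \<le> (\<Sum>z\<in>#eigenvalues (A n). g z)" for n
  proof -
    have "real (size {#z \<in># M. z \<notin> nbhd S e#}) \<le> (\<Sum>z\<in>#M. g z)" if "\<forall>z\<in>#M. cmod z \<le> L" for M
      using that by (induction M) (auto simp: g1 g0 add_increasing)
    thus ?thesis using bnd by blast
  qed
  have "(\<lambda>n. real (size {#z \<in># eigenvalues (A n). z \<notin> nbhd S e#}) / real n) \<longlonglongrightarrow> 0"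
    by (rule tendsto_sandwich[OF _ _ tendsto_const lim])
      (auto intro!: always_eventually divide_right_mono count)
  thus "(\<lambda>n. real (size {#z \<in># eigenvalues (A n). z \<notin> nbhd (essential_range \<theta> G) e#})) \<in> o(\<lambda>n. real n)"
    unfolding S_def[symmetric]
    by (intro smalloI_tendsto) (auto intro: eventually_mono[OF eventually_gt_at_top[of 0]])
qed

text \<open>The bump \<open>g\<close> of height \<open>1\<close> and radius \<open>e\<close> at \<open>s\<close> has a positive integral \<open>I\<close> because \<open>s\<close> is in the essential
  range. The number of eigenvalues within \<open>e\<close> of \<open>s\<close> is at least the sum of \<open>g\<close>, which grows linearly
  in \<open>n\<close> and so exceeds every fixed \<open>j\<close>.\<close>

lemma distribution_imp_strongly_attracts:
  assumes A: "eigenvalue_distribution A \<theta> G" and s: "s \<in> essential_range \<theta> G"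
  shows "strongly_attracts_infinite_order s A"
  unfolding strongly_attracts_infinite_order_def
proof (intro allI tendstoI)
  fix j and e :: real assume e: "e > 0"
  define g where "g z = max 0 (1 - cmod (z - s) / e)" for z
  have c: "continuous_on UNIV g" unfolding g_def using e by (intro continuous_intros) auto
  have b: "bounded {z. g z \<noteq> 0}"
    by (rule bounded_subset[OF bounded_cball[of s e]])
      (use e in \<open>auto simp: g_def dist_norm norm_minus_commute max_def field_simps split: if_splits\<close>)
  have g0: "g z \<ge> 0" for z by (simp add: g_def)
  define I where "I = (LINT t|lebesgue_on G. g (\<theta> t))"
  have "I \<noteq> 0"
  proof
    assume "I = 0"
    hence "AE t in lebesgue_on G. g (\<theta> t) = 0"
      using integral_test_function_eq_0_iff[OF c b g0] by (simp add: I_def)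
    hence "AE t in lebesgue. t \<notin> {t \<in> G. cmod (\<theta> t - s) < e}"
      unfolding AE_lebesgue_on_iff by eventually_elim (use e in \<open>auto simp: g_def max_def field_simps split: if_splits\<close>)
    hence "{t \<in> G. cmod (\<theta> t - s) < e} \<in> null_sets lebesgue"
      using sets_ball_vimage by (simp add: AE_iff_null_sets)
    thus False using s e by (auto simp: essential_range_def null_sets_def)
  qed
  moreover have "I \<ge> 0" unfolding I_def using g0 by (intro Bochner_Integration.integral_nonneg) auto
  ultimately have pos: "I / measure lebesgue G > 0" using measure_pos by simp
  \<comment> \<open>Half the limit: a positive lower bound that the averages eventually exceed.\<close>
  define h where "h = I / measure lebesgue G / 2"
  have h: "h > 0" "h < I / measure lebesgue G" using pos by (simp_all add: h_def)
  have "\<forall>\<^sub>F n in sequentially. (\<Sum>z\<in>#eigenvalues (A n). g z) / real n > h"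
    using eigenvalue_distribution_real[OF A c b] h(2) unfolding I_def by (rule order_tendstoD)
  moreover have "\<forall>\<^sub>F n in sequentially. real n > real j / h"
    by (rule eventually_compose_filterlim[OF eventually_gt_at_top filterlim_real_sequentially])
  moreover have "\<forall>\<^sub>F n in sequentially. n > 0" by (rule eventually_gt_at_top)
  ultimately show "\<forall>\<^sub>F n in sequentially.
      dist (sorted_list_of_multiset (image_mset (\<lambda>z. cmod (z - s)) (eigenvalues (A n))) ! j) 0 < e"
  proof eventually_elim
    case (elim n)
    let ?M = "image_mset (\<lambda>z. cmod (z - s)) (eigenvalues (A n))"
    have "(\<Sum>z\<in>#M. g z) \<le> real (size {#x \<in># image_mset (\<lambda>z. cmod (z - s)) M. x < e#})" for M
    proof (induction M)
      case (add z M)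
      have "g z \<le> 1" "cmod (z - s) \<ge> e \<Longrightarrow> g z = 0" using e by (auto simp: g_def)
      thus ?case using add by auto
    qed simp
    moreover have "real j < (\<Sum>z\<in>#eigenvalues (A n). g z)"
    proof -
      have "real j < h * real n" using elim(2) h(1) by (simp add: field_simps)
      also have "\<dots> < (\<Sum>z\<in>#eigenvalues (A n). g z)" using elim(1,3) by (simp add: field_simps)
      finally show ?thesis .
    qed
    ultimately have "real j < real (size {#x \<in># ?M. x < e#})" by (rule less_le_trans[rotated])
    hence nth: "sorted_list_of_multiset ?M ! j < e \<and> j < size ?M"
      by (intro nth_sorted_less_if_many) simp
    hence "sorted_list_of_multiset ?M ! j \<in> set (sorted_list_of_multiset ?M)"
      by (intro nth_mem) (metis mset_sorted_list_of_multiset size_mset)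
    hence "sorted_list_of_multiset ?M ! j \<ge> 0" by auto
    thus ?case using nth by simp
  qed
qed

end

section \<open>Perturbed Hermitian matrix sequences\<close>

lemma asymptotically_close_eigenvalues:
  fixes B C :: "nat \<Rightarrow> complex mat"
  assumes B: "matrix_sequence B" and C: "matrix_sequence C"
    and herm: "\<forall>\<^sub>F n in sequentially. hermitian_mat (B n)"
    and K: "K > 0" "\<And>n. op_bound (B n) K" "\<And>n. op_bound (C n) K"
    and t: "(\<lambda>n. trace_norm (C n)) \<in> o(\<lambda>n. real n)"
  shows "asymptotically_close (\<lambda>n. eigenvalues (B n + C n)) (\<lambda>n. eigenvalues (B n))
    (2 * K + 1) (\<lambda>n. trace_norm (C n))"
  unfolding asymptotically_close_def
proof (intro conjI)
  have Bn: "B n \<in> carrier_mat n n" and Cn: "C n \<in> carrier_mat n n" for n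
    using B C by (auto simp: matrix_sequence_def)
  \<comment> \<open>\<open>2 * K\<close> bounds both spectra; the summand \<open>1\<close> serves to make the radius at least \<open>1\<close>.\<close>
  have bA: "op_bound (B n + C n) (2 * K + 1)" and bB: "op_bound (B n) (2 * K + 1)" for n
    using K(1) by (auto intro: op_bound_mono[OF op_bound_add[OF Bn Cn K(2,3)]] op_bound_mono[OF K(2)])
  show "2 * K + 1 \<ge> 1" using K by simp
  show "(\<lambda>n. trace_norm (C n) / real n) \<longlonglongrightarrow> 0" using t by (rule smalloD_tendsto)
  show "\<forall>\<^sub>F n in sequentially. size (eigenvalues (B n + C n)) = n \<and> size (eigenvalues (B n)) = n \<and>
      (\<forall>z\<in>#eigenvalues (B n + C n). cmod z \<le> 2 * K + 1) \<and>
      (\<forall>z\<in>#eigenvalues (B n). cmod z \<le> 2 * K + 1 \<and> Im z = 0) \<and>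
      (\<Sum>z\<in>#eigenvalues (B n + C n). \<bar>Im z\<bar>) \<le> trace_norm (C n) \<and>
      (\<forall>k. cmod ((\<Sum>z\<in>#eigenvalues (B n + C n). z ^ k) - (\<Sum>z\<in>#eigenvalues (B n). z ^ k))
        \<le> real k * (2 * K + 1) ^ k * trace_norm (C n))"
    using herm
  proof eventually_elim
    case (elim n)
    have An: "B n + C n \<in> carrier_mat n n" using Bn Cn by simp
    show ?case
      using size_eigenvalues[OF An] size_eigenvalues[OF Bn] eigenvalue_le_op_bound[OF An bA]
        eigenvalue_le_op_bound[OF Bn bB] hermitian_eigenvalues_real[OF Bn elim]
        sum_Im_eigenvalues_le[OF Bn elim Cn] power_sum_eigenvalues_diff_le[OF Bn Cn bA bB] K(1)
      by auto
  qed
qed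

theorem theorem3p4:
  fixes B C :: "nat \<Rightarrow> complex mat"
    and G :: "(real ^ 'q) set"
    and \<theta> :: "real ^ 'q \<Rightarrow> complex"
    and K :: real
  assumes "matrix_sequence B" and "matrix_sequence C"
    and "eventually (\<lambda>n. hermitian_mat (B n)) sequentially"
    and "G \<in> sets lebesgue" and "0 < emeasure lebesgue G" and "emeasure lebesgue G < \<infinity>"
    and "\<theta> \<in> borel_measurable (lebesgue_on G)"
    and "eigenvalue_distribution B \<theta> G"
    and "K > 0"
    and "\<And>n. spectral_norm (B n) \<le> K" and "\<And>n. spectral_norm (C n) \<le> K"
    and "(\<lambda>n. trace_norm (C n)) \<in> o(\<lambda>n. real n)"
  shows "(AE t in lebesgue_on G. \<theta> t \<in> \<real>)
    \<and> eigenvalue_distribution (\<lambda>n. B n + C n) \<theta> G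
    \<and> weakly_clustered (\<lambda>n. B n + C n) (essential_range \<theta> G)
    \<and> (\<forall>s \<in> essential_range \<theta> G. strongly_attracts_infinite_order s (\<lambda>n. B n + C n))"
proof -
  note G\<theta> = assms(4-7)
  have Bn: "B n \<in> carrier_mat n n" and Cn: "C n \<in> carrier_mat n n" for n
    using assms(1,2) by (auto simp: matrix_sequence_def)
  have bB: "op_bound (B n) K" and bC: "op_bound (C n) K" for n
    using assms(10,11) op_bound_spectral_norm op_bound_mono by blast+
  have close: "asymptotically_close (\<lambda>n. eigenvalues (B n + C n)) (\<lambda>n. eigenvalues (B n))
      (2 * K + 1) (\<lambda>n. trace_norm (C n))"
    by (rule asymptotically_close_eigenvalues[OF assms(1-3,9) bB bC assms(12)])
  have distr: "eigenvalue_distribution (\<lambda>n. B n + C n) \<theta> G"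
    unfolding eigenvalue_distribution_def
  proof (intro allI impI)
    fix F :: "complex \<Rightarrow> complex" assume F: "continuous_on UNIV F" "bounded {z. F z \<noteq> 0}"
    have "(\<lambda>n. (\<Sum>z\<in>#eigenvalues (B n). F z) / of_nat n)
        \<longlonglongrightarrow> (LINT t|lebesgue_on G. F (\<theta> t)) / of_real (measure lebesgue G)"
      using assms(8) F unfolding eigenvalue_distribution_def by blast
    from tendsto_add[OF asymptotically_close_imp_same_averages[OF close F(1)] this]
    show "(\<lambda>n. (\<Sum>z\<in>#eigenvalues (B n + C n). F z) / of_nat n)
        \<longlonglongrightarrow> (LINT t|lebesgue_on G. F (\<theta> t)) / of_real (measure lebesgue G)"
      by (simp add: diff_divide_distrib)
  qed
  have "\<forall>\<^sub>F n in sequentially. \<forall>z\<in>#eigenvalues (B n). Im z = 0"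
    using assms(3) by eventually_elim (use hermitian_eigenvalues_real[OF Bn] in blast)
  hence real: "AE t in lebesgue_on G. \<theta> t \<in> \<real>"
    by (rule distribution_real_imp_AE_real[OF G\<theta> assms(8)])
  have "cmod z \<le> K + K" if "z \<in># eigenvalues (B n + C n)" for n z
    using eigenvalue_le_op_bound[OF add_carrier_mat[OF Cn] op_bound_add[OF Bn Cn bB bC] that] .
  hence "weakly_clustered (\<lambda>n. B n + C n) (essential_range \<theta> G)"
    by (rule distribution_imp_weakly_clustered[OF G\<theta> distr])
  thus ?thesis using real distr distribution_imp_strongly_attracts[OF G\<theta> distr] by blast
qed

end
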